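(* Let $Z_1=(X,Y)$ be the planar piecewise smooth vector field on $\mathbb{R}^2$ given by $X(x,y)=(1,-2x+1)$ for $y\ge0$ and $Y(x,y)=(-1,-(-2+x)(-22+x(-7+4x)))$ for $y\le0$, with switching manifold $\Sigma=f^{-1}(0)=\{(x,y)\in\mathbb{R}^{2}: y=0\}$, $f(x,y)=y$. Then the set $$\Lambda_{1}=\{(x,y)\in\mathbb{R}^{2}: -3\leq x\leq 4 \text{ and } (-4+x)(-2+x)^2(3+x)\leq y\leq -(-4+x)(3+x)\}$$ is $Z_1$-minimal, but it is neither $Z_1$-positively minimal nor $Z_1$-negatively minimal.
   Context: **Piecewise smooth vector fields (PSVFs).** Let $V\subset\mathbb{R}^2$ be a neighborhood of $0$ (here $V=\mathbb{R}^2$), $f:V\to\mathbb{R}$ smooth with $0$ a regular value, $\Sigma=f^{-1}(0)$ (the switching manifold), $\Sigma^+=\{q\in V: f(q)\ge 0\}$, $\Sigma^-=\{q\in V: f(q)\le 0\}$. A PSVF $Z=(X,Y)$ equals $X$ on $\Sigma^+$ and $Y$ on $\Sigma^-$, where $X,Y$ are $C^r$ vector fields on $V$ ($r\ge1$ large enough); it is allowed to be multivalued on $\Sigma$. The set of PSVFs is $\Omega$. Write $X.f(p)=\langle\nabla f(p),X(p)\rangle$, and similarly $Y.f$. On $\Sigma$ one distinguishes the sewing region $\Sigma^c$: $(X.f)(Y.f)>0$; the escaping region $\Sigma^e$: $X.f>0$, $Y.f<0$; the sliding region $\Sigma^s$: $X.f<0$, $Y.f>0$. On $\Sigma^s$ the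 sliding vector field is $Z^s(q)=m-q$, where $m$ is the point of the segment joining $q+X(q)$ and $q+Y(q)$ such that $m-q$ is tangent to $\Sigma$; on $\Sigma^e$ the escaping vector field is $Z^e=-(-Z)^s$. Both are denoted $Z^\Sigma$. A tangency point is $q\in\Sigma$ with $(X.f(q))(Y.f(q))=0$. A tangency of $X$ (resp. $Y$) at $q$ is visible if there is an orbit of $X$ in $\Sigma^+$ (resp. of $Y$ in $\Sigma^-$) reaching $q$ in finite time, and invisible otherwise. A tangency point is singular if it is an invisible tangency for both $X$ and $Y$, and regular otherwise. **Local trajectories** $\phi_Z(t,p)$, $t$ in an interval $I\ni 0$ (arcs of $X$ lie in $\Sigma^+$, arcs of $Y$ lie in $\Sigma^-$, arcs of $Z^\Sigma$ lie in $\Sigma^e\cup\Sigma^s$ and its limit tangency points, where $Z^\Sigma$ is extended by continuity): - $p\in\Sigma^+\setminus\Sigma$: $\phi_Z=\phi_X$; $p\in\Sigma^-\setminus\Sigma$: $\phi_Z=\phi_Y$. - $p\in\Sigma^c$ with $X.f(p),Y.f(p)>0$: $\phi_Z=\phi_Y$ for $t\le0$ and $\phi_Z=\phi_X$ for $t\ge0$; if $X.f(p),Y.f(p)<0$, the same reversing time. - $p\in\Sigma^e$: $\phi_Z=\phi_{Z^\Sigma}$ for $t\le 0$, and for $t\ge0$ $\phi_Z$ is any one of $\phi_X$, $\phi_Y$, $\phi_{Z^\Sigma}$; for $p\in\Sigma^s$, the same reversing time. - $p$ a regular tangency point: $\phi_Z=\phi_1$ for $t\le0$ and $\phi_Z=\phi_2$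 for $t\ge0$, where each of $\phi_1,\phi_2$ is one of $\phi_X,\phi_Y,\phi_{Z^\Sigma}$. - $p$ a singular tangency point: $\phi_Z(t,p)=p$ for all $t\in\mathbb{R}$. **Global trajectories.** A global trajectory $\Gamma_Z(t,p_0)$ of $Z$ through $p_0$ is a union $\bigcup_{i\in\mathbb{Z}}\{\sigma_i(t,p_i): t_i\le t\le t_{i+1}\}$ of orientation-preserving local trajectories $\sigma_i$ with $\sigma_i(t_{i+1},p_i)=\sigma_{i+1}(t_{i+1},p_{i+1})=p_{i+1}$ and $t_i\to\pm\infty$ as $i\to\pm\infty$. It is a positive (resp. negative) global trajectory if $i\in\mathbb{N}$ (resp. $-i\in\mathbb{N}$) and $t_0=0$. Global trajectories through a given point need not be unique. **Invariance and minimality.** A set $A\subset\mathbb{R}^2$ is $Z$-invariant (resp. $Z$-positively invariant, $Z$-negatively invariant) if for each $p\in A$ every global trajectory (resp. positive global trajectory, negative global trajectory) through $p$ is contained in $A$. A set $M\subset\mathbb{R}^2$ is $Z$-minimal (resp. $Z$-positively minimal, $Z$-negatively minimal) if (i) $M\ne\emptyset$; (ii) $M$ is compact; (iii) $M$ is $Z$-invariant (resp. $Z$-positively invariant, $Z$-negatively invariant); (iv) $M$ contains no proper subset satisfying (i), (ii) and (iii). *)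

theory Defs
  imports "HOL-Analysis.Analysis"
begin

section \<open>Planar piecewise smooth vector fields\<close>

text \<open>
  A piecewise smooth vector field \<open>Z = (X, Y)\<close> with switching function \<open>f\<close> is given by the three
  parameters \<open>f\<close>, \<open>X\<close>, \<open>Y\<close>. Both fields are defined on the whole plane; \<open>X\<close> is only ever followed
  inside \<open>\<Sigma>\<^sup>+\<close> and \<open>Y\<close> only inside \<open>\<Sigma>\<^sup>-\<close>.
\<close>

type_synonym plane = "real \<times> real"
type_synonym vfield = "plane \<Rightarrow> plane"

subsection \<open>The switching manifold and its regions\<close>

definition switching_manifold :: "(plane \<Rightarrow> real) \<Rightarrow> plane set" where
  "switching_manifold f = {q. f q = 0}"

definition upper_region :: "(plane \<Rightarrow> real) \<Rightarrow> plane set" where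
  "upper_region f = {q. f q \<ge> 0}"

definition lower_region :: "(plane \<Rightarrow> real) \<Rightarrow> plane set" where
  "lower_region f = {q. f q \<le> 0}"

definition gradient :: "(plane \<Rightarrow> real) \<Rightarrow> plane \<Rightarrow> plane" where
  "gradient f q = (THE D. GDERIV f q :> D)"

definition lie_deriv :: "(plane \<Rightarrow> real) \<Rightarrow> vfield \<Rightarrow> plane \<Rightarrow> real" where
  "lie_deriv f F q = gradient f q \<bullet> F q"

definition sewing_up :: "(plane \<Rightarrow> real) \<Rightarrow> vfield \<Rightarrow> vfield \<Rightarrow> plane set" where
  "sewing_up f X Y = {q \<in> switching_manifold f. lie_deriv f X q > 0 \<and> lie_deriv f Y q > 0}"

definition sewing_down :: "(plane \<Rightarrow> real) \<Rightarrow> vfield \<Rightarrow> vfield \<Rightarrow> plane set" where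
  "sewing_down f X Y = {q \<in> switching_manifold f. lie_deriv f X q < 0 \<and> lie_deriv f Y q < 0}"

definition escaping_region :: "(plane \<Rightarrow> real) \<Rightarrow> vfield \<Rightarrow> vfield \<Rightarrow> plane set" where
  "escaping_region f X Y = {q \<in> switching_manifold f. lie_deriv f X q > 0 \<and> lie_deriv f Y q < 0}"

definition sliding_region :: "(plane \<Rightarrow> real) \<Rightarrow> vfield \<Rightarrow> vfield \<Rightarrow> plane set" where
  "sliding_region f X Y = {q \<in> switching_manifold f. lie_deriv f X q < 0 \<and> lie_deriv f Y q > 0}"

definition tangency_points :: "(plane \<Rightarrow> real) \<Rightarrow> vfield \<Rightarrow> vfield \<Rightarrow> plane set" where
  "tangency_points f X Y = {q \<in> switching_manifold f. lie_deriv f X q * lie_deriv f Y q = 0}"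

subsection \<open>Sliding and escaping vector fields\<close>

definition sliding_vf :: "(plane \<Rightarrow> real) \<Rightarrow> vfield \<Rightarrow> vfield \<Rightarrow> vfield" where
  "sliding_vf f X Y q =
     (THE m. m \<in> closed_segment (q + X q) (q + Y q) \<and> gradient f q \<bullet> (m - q) = 0) - q"

definition escaping_vf :: "(plane \<Rightarrow> real) \<Rightarrow> vfield \<Rightarrow> vfield \<Rightarrow> vfield" where
  "escaping_vf f X Y q = - sliding_vf f (\<lambda>p. - X p) (\<lambda>p. - Y p) q"

definition sigma_vf_open :: "(plane \<Rightarrow> real) \<Rightarrow> vfield \<Rightarrow> vfield \<Rightarrow> vfield" where
  "sigma_vf_open f X Y q =
     (if q \<in> sliding_region f X Y then sliding_vf f X Y q else escaping_vf f X Y q)"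

text \<open>
  The tangency points adherent to \<open>\<Sigma>\<^sup>e \<union> \<Sigma>\<^sup>s\<close> to which \<open>Z\<^sup>\<Sigma>\<close> extends by continuity.
\<close>

definition sigma_limit_tangencies :: "(plane \<Rightarrow> real) \<Rightarrow> vfield \<Rightarrow> vfield \<Rightarrow> plane set" where
  "sigma_limit_tangencies f X Y =
     {q \<in> tangency_points f X Y.
        q islimpt (escaping_region f X Y \<union> sliding_region f X Y) \<and>
        (\<exists>v. (sigma_vf_open f X Y \<longlongrightarrow> v)
               (at q within (escaping_region f X Y \<union> sliding_region f X Y)))}"

definition sigma_domain :: "(plane \<Rightarrow> real) \<Rightarrow> vfield \<Rightarrow> vfield \<Rightarrow> plane set" where
  "sigma_domain f X Y =
     escaping_region f X Y \<union> sliding_region f X Y \<union> sigma_limit_tangencies f X Y"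

definition sigma_vf :: "(plane \<Rightarrow> real) \<Rightarrow> vfield \<Rightarrow> vfield \<Rightarrow> vfield" where
  "sigma_vf f X Y q =
     (if q \<in> escaping_region f X Y \<union> sliding_region f X Y then sigma_vf_open f X Y q
      else Lim (at q within (escaping_region f X Y \<union> sliding_region f X Y)) (sigma_vf_open f X Y))"

subsection \<open>Arcs and tangencies\<close>

text \<open>
  \<open>integral_arc F D J \<phi>\<close>: on the time interval \<open>J\<close>, \<open>\<phi>\<close> is a solution of \<open>\<phi>' = F \<phi>\<close> staying in \<open>D\<close>.
  At an endpoint of \<open>J\<close> the derivative is one-sided.
\<close>

definition integral_arc :: "vfield \<Rightarrow> plane set \<Rightarrow> real set \<Rightarrow> (real \<Rightarrow> plane) \<Rightarrow> bool" where
  "integral_arc F D J \<phi> \<longleftrightarrow>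
     (\<forall>t\<in>J. \<phi> t \<in> D \<and> (\<phi> has_vector_derivative F (\<phi> t)) (at t within J))"

definition X_arc :: "(plane \<Rightarrow> real) \<Rightarrow> vfield \<Rightarrow> real set \<Rightarrow> (real \<Rightarrow> plane) \<Rightarrow> bool" where
  "X_arc f X J \<phi> \<longleftrightarrow> integral_arc X (upper_region f) J \<phi>"

definition Y_arc :: "(plane \<Rightarrow> real) \<Rightarrow> vfield \<Rightarrow> real set \<Rightarrow> (real \<Rightarrow> plane) \<Rightarrow> bool" where
  "Y_arc f Y J \<phi> \<longleftrightarrow> integral_arc Y (lower_region f) J \<phi>"

definition sigma_arc ::
  "(plane \<Rightarrow> real) \<Rightarrow> vfield \<Rightarrow> vfield \<Rightarrow> real set \<Rightarrow> (real \<Rightarrow> plane) \<Rightarrow> bool" where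
  "sigma_arc f X Y J \<phi> \<longleftrightarrow> integral_arc (sigma_vf f X Y) (sigma_domain f X Y) J \<phi>"

definition some_arc ::
  "(plane \<Rightarrow> real) \<Rightarrow> vfield \<Rightarrow> vfield \<Rightarrow> real set \<Rightarrow> (real \<Rightarrow> plane) \<Rightarrow> bool" where
  "some_arc f X Y J \<phi> \<longleftrightarrow> X_arc f X J \<phi> \<or> Y_arc f Y J \<phi> \<or> sigma_arc f X Y J \<phi>"

text \<open>
  Some nondegenerate orbit arc of \<open>F\<close> inside the closed region \<open>D\<close> reaches \<open>q\<close>, in forward or in
  backward time. A tangency of \<open>X\<close> (\<open>Y\<close>) is visible if this holds for \<open>\<Sigma>\<^sup>+\<close> (\<open>\<Sigma>\<^sup>-\<close>).
\<close>

definition reached_within :: "vfield \<Rightarrow> plane set \<Rightarrow> plane \<Rightarrow> bool" where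
  "reached_within F D q \<longleftrightarrow>
     (\<exists>s>0. \<exists>\<phi>. \<phi> 0 = q \<and> (integral_arc F D {-s..0} \<phi> \<or> integral_arc F D {0..s} \<phi>))"

definition invisible_X_tangency :: "(plane \<Rightarrow> real) \<Rightarrow> vfield \<Rightarrow> plane \<Rightarrow> bool" where
  "invisible_X_tangency f X q \<longleftrightarrow>
     q \<in> switching_manifold f \<and> lie_deriv f X q = 0 \<and> \<not> reached_within X (upper_region f) q"

definition invisible_Y_tangency :: "(plane \<Rightarrow> real) \<Rightarrow> vfield \<Rightarrow> plane \<Rightarrow> bool" where
  "invisible_Y_tangency f Y q \<longleftrightarrow>
     q \<in> switching_manifold f \<and> lie_deriv f Y q = 0 \<and> \<not> reached_within Y (lower_region f) q"

definition singular_tangencies :: "(plane \<Rightarrow> real) \<Rightarrow> vfield \<Rightarrow> vfield \<Rightarrow> plane set" where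
  "singular_tangencies f X Y =
     {q \<in> tangency_points f X Y. invisible_X_tangency f X q \<and> invisible_Y_tangency f Y q}"

definition regular_tangencies :: "(plane \<Rightarrow> real) \<Rightarrow> vfield \<Rightarrow> vfield \<Rightarrow> plane set" where
  "regular_tangencies f X Y = tangency_points f X Y - singular_tangencies f X Y"

subsection \<open>Local trajectories\<close>

text \<open>
  \<open>local_trajectory f X Y p I \<phi>\<close>: \<open>\<phi>\<close>, on the time interval \<open>I\<close>, is a local trajectory \<open>\<phi>\<^sub>Z(\<cdot>, p)\<close>.
  The hypotheses of the implications are exhaustive and mutually exclusive.
\<close>

definition local_trajectory ::
  "(plane \<Rightarrow> real) \<Rightarrow> vfield \<Rightarrow> vfield \<Rightarrow> plane \<Rightarrow> real set \<Rightarrow> (real \<Rightarrow> plane) \<Rightarrow> bool" where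
  "local_trajectory f X Y p I \<phi> \<longleftrightarrow>
     is_interval I \<and> 0 \<in> I \<and> \<phi> 0 = p \<and>
     (p \<in> upper_region f - switching_manifold f \<longrightarrow> X_arc f X I \<phi>) \<and>
     (p \<in> lower_region f - switching_manifold f \<longrightarrow> Y_arc f Y I \<phi>) \<and>
     (p \<in> sewing_up f X Y \<longrightarrow> Y_arc f Y (I \<inter> {..0}) \<phi> \<and> X_arc f X (I \<inter> {0..}) \<phi>) \<and>
     (p \<in> sewing_down f X Y \<longrightarrow> X_arc f X (I \<inter> {..0}) \<phi> \<and> Y_arc f Y (I \<inter> {0..}) \<phi>) \<and>
     (p \<in> escaping_region f X Y \<longrightarrow>
        sigma_arc f X Y (I \<inter> {..0}) \<phi> \<and> some_arc f X Y (I \<inter> {0..}) \<phi>) \<and>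
     (p \<in> sliding_region f X Y \<longrightarrow>
        some_arc f X Y (I \<inter> {..0}) \<phi> \<and> sigma_arc f X Y (I \<inter> {0..}) \<phi>) \<and>
     (p \<in> regular_tangencies f X Y \<longrightarrow>
        some_arc f X Y (I \<inter> {..0}) \<phi> \<and> some_arc f X Y (I \<inter> {0..}) \<phi>) \<and>
     (p \<in> singular_tangencies f X Y \<longrightarrow> (\<forall>t\<in>I. \<phi> t = p))"

subsection \<open>Global trajectories\<close>

text \<open>
  The pieces \<open>\<sigma> i\<close>, \<open>i \<in> K\<close>, of a global trajectory: \<open>\<sigma> i\<close> is a local trajectory through \<open>p i\<close>,
  shifted in time so that it is at \<open>p i\<close> at time \<open>\<tau> i\<close>, and it is followed forward in time until
  \<open>\<tau> (i + 1)\<close>, when it is at \<open>p (i + 1)\<close>.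
\<close>

definition trajectory_chain ::
  "(plane \<Rightarrow> real) \<Rightarrow> vfield \<Rightarrow> vfield \<Rightarrow> int set \<Rightarrow> (int \<Rightarrow> real) \<Rightarrow> (int \<Rightarrow> plane) \<Rightarrow>
     (int \<Rightarrow> real \<Rightarrow> plane) \<Rightarrow> bool" where
  "trajectory_chain f X Y K \<tau> p \<sigma> \<longleftrightarrow>
     (\<forall>i\<in>K. \<tau> i < \<tau> (i + 1) \<and>
        local_trajectory f X Y (p i) {0..\<tau> (i + 1) - \<tau> i} (\<lambda>s. \<sigma> i (\<tau> i + s)) \<and>
        \<sigma> i (\<tau> (i + 1)) = p (i + 1))"

definition chain_image ::
  "int set \<Rightarrow> (int \<Rightarrow> real) \<Rightarrow> (int \<Rightarrow> real \<Rightarrow> plane) \<Rightarrow> plane set" where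
  "chain_image K \<tau> \<sigma> = (\<Union>i\<in>K. {\<sigma> i t |t. \<tau> i \<le> t \<and> t \<le> \<tau> (i + 1)})"

text \<open>
  The set \<open>\<Gamma>\<close> is a global (positive global, negative global) trajectory through \<open>p0\<close>. A positive one
  starts at \<open>p0\<close> at time \<open>0\<close>; a negative one ends at \<open>p0\<close> at time \<open>0\<close>, so that its last piece is
  the one with index \<open>-1\<close>, running from \<open>\<tau> (-1)\<close> to \<open>\<tau> 0 = 0\<close>.
\<close>

definition global_trajectory ::
  "(plane \<Rightarrow> real) \<Rightarrow> vfield \<Rightarrow> vfield \<Rightarrow> plane \<Rightarrow> plane set \<Rightarrow> bool" where
  "global_trajectory f X Y p0 \<Gamma> \<longleftrightarrow>
     (\<exists>\<tau> p \<sigma>. trajectory_chain f X Y UNIV \<tau> p \<sigma> \<and>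
        filterlim \<tau> at_top at_top \<and> filterlim \<tau> at_bot at_bot \<and>
        p 0 = p0 \<and> \<Gamma> = chain_image UNIV \<tau> \<sigma>)"

definition positive_global_trajectory ::
  "(plane \<Rightarrow> real) \<Rightarrow> vfield \<Rightarrow> vfield \<Rightarrow> plane \<Rightarrow> plane set \<Rightarrow> bool" where
  "positive_global_trajectory f X Y p0 \<Gamma> \<longleftrightarrow>
     (\<exists>\<tau> p \<sigma>. trajectory_chain f X Y {0..} \<tau> p \<sigma> \<and>
        filterlim \<tau> at_top at_top \<and> \<tau> 0 = 0 \<and>
        p 0 = p0 \<and> \<Gamma> = chain_image {0..} \<tau> \<sigma>)"

definition negative_global_trajectory ::
  "(plane \<Rightarrow> real) \<Rightarrow> vfield \<Rightarrow> vfield \<Rightarrow> plane \<Rightarrow> plane set \<Rightarrow> bool" where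
  "negative_global_trajectory f X Y p0 \<Gamma> \<longleftrightarrow>
     (\<exists>\<tau> p \<sigma>. trajectory_chain f X Y {..-1} \<tau> p \<sigma> \<and>
        filterlim \<tau> at_bot at_bot \<and> \<tau> 0 = 0 \<and>
        p 0 = p0 \<and> \<Gamma> = chain_image {..-1} \<tau> \<sigma>)"

subsection \<open>Invariance and minimality\<close>

definition Z_invariant :: "(plane \<Rightarrow> real) \<Rightarrow> vfield \<Rightarrow> vfield \<Rightarrow> plane set \<Rightarrow> bool" where
  "Z_invariant f X Y A \<longleftrightarrow> (\<forall>p\<in>A. \<forall>\<Gamma>. global_trajectory f X Y p \<Gamma> \<longrightarrow> \<Gamma> \<subseteq> A)"

definition Z_positively_invariant :: "(plane \<Rightarrow> real) \<Rightarrow> vfield \<Rightarrow> vfield \<Rightarrow> plane set \<Rightarrow> bool" where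
  "Z_positively_invariant f X Y A \<longleftrightarrow>
     (\<forall>p\<in>A. \<forall>\<Gamma>. positive_global_trajectory f X Y p \<Gamma> \<longrightarrow> \<Gamma> \<subseteq> A)"

definition Z_negatively_invariant :: "(plane \<Rightarrow> real) \<Rightarrow> vfield \<Rightarrow> vfield \<Rightarrow> plane set \<Rightarrow> bool" where
  "Z_negatively_invariant f X Y A \<longleftrightarrow>
     (\<forall>p\<in>A. \<forall>\<Gamma>. negative_global_trajectory f X Y p \<Gamma> \<longrightarrow> \<Gamma> \<subseteq> A)"

definition minimal_for :: "(plane set \<Rightarrow> bool) \<Rightarrow> plane set \<Rightarrow> bool" where
  "minimal_for Inv M \<longleftrightarrow>
     M \<noteq> {} \<and> compact M \<and> Inv M \<and> \<not> (\<exists>N. N \<subset> M \<and> N \<noteq> {} \<and> compact N \<and> Inv N)"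

definition Z_minimal :: "(plane \<Rightarrow> real) \<Rightarrow> vfield \<Rightarrow> vfield \<Rightarrow> plane set \<Rightarrow> bool" where
  "Z_minimal f X Y M \<longleftrightarrow> minimal_for (Z_invariant f X Y) M"

definition Z_positively_minimal :: "(plane \<Rightarrow> real) \<Rightarrow> vfield \<Rightarrow> vfield \<Rightarrow> plane set \<Rightarrow> bool" where
  "Z_positively_minimal f X Y M \<longleftrightarrow> minimal_for (Z_positively_invariant f X Y) M"

definition Z_negatively_minimal :: "(plane \<Rightarrow> real) \<Rightarrow> vfield \<Rightarrow> vfield \<Rightarrow> plane set \<Rightarrow> bool" where
  "Z_negatively_minimal f X Y M \<longleftrightarrow> minimal_for (Z_negatively_invariant f X Y) M"

section \<open>The vector field \<open>Z\<^sub>1\<close> and the set \<open>\<Lambda>\<^sub>1\<close>\<close>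

definition f1 :: "plane \<Rightarrow> real" where
  "f1 = (\<lambda>(x, y). y)"

definition X1 :: vfield where
  "X1 = (\<lambda>(x, y). (1, - 2 * x + 1))"

definition Y1 :: vfield where
  "Y1 = (\<lambda>(x, y). (- 1, - ((- 2 + x) * (- 22 + x * (- 7 + 4 * x)))))"

definition Lambda1 :: "plane set" where
  "Lambda1 = {(x, y). - 3 \<le> x \<and> x \<le> 4 \<and>
     (- 4 + x) * (- 2 + x)\<^sup>2 * (3 + x) \<le> y \<and> y \<le> - ((- 4 + x) * (3 + x))}"

end

theory Submission
  imports Defs
begin

text \<open>
  The field \<open>X\<^sub>1\<close> has the first integral \<open>y + x\<^sup>2 - x\<close>, the field \<open>Y\<^sub>1\<close> has
  \<open>y - (x - 4) * (x - 2)\<^sup>2 * (x + 3)\<close>, and \<open>\<Lambda>\<^sub>1\<close> is cut out of the upper and of the lower half plane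
  by one inequality for the respective integral. The sliding and the escaping segment lie inside
  \<open>\<Lambda>\<^sub>1\<close>, so no arc crosses its boundary, forwards or backwards: \<open>\<Lambda>\<^sub>1\<close> is invariant
  (\<open>Z_invariant_Lambda1\<close>).

  On the switching line \<open>Z\<^sup>\<Sigma>\<close> has three zeros: \<open>r0\<close> in the escaping segment, which repels
  escaping points, and \<open>r1 < r2\<close> in the sliding segment, of which \<open>r2\<close> attracts. A positive
  trajectory from \<open>r2\<close> can only slide and so stays there, and a negative trajectory from \<open>r0\<close>
  can only escape backwards and so stays there. Hence \<open>{r2}\<close> is a positively invariant and
  \<open>{r0}\<close> a negatively invariant compact proper subset, and \<open>\<Lambda>\<^sub>1\<close> has neither of the one-sided
  minimality properties.

  Invariance in both time directions is much more demanding. If a single local piece leads from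
  \<open>p\<close> to \<open>q\<close>, and if it can be prolonged to a trajectory for all times, then an invariant set
  contains \<open>p\<close> if and only if it contains \<open>q\<close> (\<open>Z_invariant_step_iff\<close>). A prolongation exists
  at every point of \<open>\<Lambda>\<^sub>1\<close> (\<open>endless_Lambda1\<close>): forwards it ends up on the closed orbit that
  bounds \<open>\<Lambda>\<^sub>1\<close>, at \<open>r1\<close>, or creeping towards \<open>r2\<close>, and backwards it creeps towards \<open>r0\<close>. It
  then remains to see that the undirected graph of local pieces on \<open>\<Lambda>\<^sub>1\<close> is connected
  (\<open>invariant_subset_eq_Lambda1\<close>). Its three kinds of edges are the reflection \<open>x \<mapsto> 1 - x\<close> of
  the switching line given by \<open>X\<^sub>1\<close>, the pairing of equal levels of the quartic given by \<open>Y\<^sub>1\<close>,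
  and motion along the sliding and escaping segments between pseudo-equilibria; the reflection
  moves \<open>r0\<close> strictly between \<open>r1\<close> and \<open>r2\<close>, so that no pseudo-equilibrium separates the graph.
\<close>

section \<open>Motion on the real line\<close>

text \<open>
  Separation of variables: \<open>F x = \<integral> 1 / g\<close> is the travel time, and its inverse solves
  \<open>\<phi>' = g \<phi>\<close>. Freezing \<open>g\<close> outside \<open>{u..v}\<close> lets \<open>F\<close> be differentiable on a neighbourhood of the
  interval, so that the endpoints need no separate treatment.
\<close>

lemma autonomous_arc_increasing:
  fixes g :: "real \<Rightarrow> real"
  assumes uv: "u < v" and cont: "continuous_on {u..v} g"
    and pos: "\<And>x. x \<in> {u..v} \<Longrightarrow> 0 < g x"
  obtains T \<phi> where "0 < T" "\<phi> 0 = u" "\<phi> T = v"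
    "\<And>t. t \<in> {0..T} \<Longrightarrow> \<phi> t \<in> {u..v}"
    "\<And>t. t \<in> {0..T} \<Longrightarrow> (\<phi> has_real_derivative g (\<phi> t)) (at t within {0..T})"
proof -
  define G where "G x = g (max u (min v x))" for x
  have G_pos: "0 < G x" for x using pos uv by (simp add: G_def)
  have G_eq: "G x = g x" if "x \<in> {u..v}" for x using that by (simp add: G_def)
  have G_cont: "continuous_on A G" for A
    unfolding G_def using uv
    by (intro continuous_on_compose2[OF cont] continuous_intros) auto
  define F where "F x = integral {u - 1..x} (\<lambda>s. 1 / G s)" for x
  have dF: "(F has_real_derivative 1 / G x) (at x)" if "u - 1 < x" "x < v + 1" for x
  proof -
    have "continuous_on {u - 1..v + 1} (\<lambda>s. 1 / G s)"
      using G_pos by (intro continuous_intros G_cont) (simp add: less_imp_neq[symmetric])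
    then have "((\<lambda>x. integral {u - 1..x} (\<lambda>s. 1 / G s)) has_real_derivative 1 / G x)
        (at x within {u - 1..v + 1})"
      using that by (intro integral_has_real_derivative) auto
    then show ?thesis
      using that by (simp add: F_def[abs_def] at_within_Icc_at)
  qed
  define a where "a = u - 1/2"
  define b where "b = v + 1/2"
  have ab: "u - 1 < a" "a < u" "v < b" "b < v + 1" by (auto simp: a_def b_def)
  have F_less: "F x < F y" if "a \<le> x" "x < y" "y \<le> b" for x y
  proof (rule DERIV_pos_imp_increasing[OF that(2)])
    fix z assume "x \<le> z" "z \<le> y"
    then show "\<exists>d. (F has_real_derivative d) (at z) \<and> 0 < d"
      using dF[of z] that ab G_pos by (intro exI[of _ "1 / G z"]) auto
  qed
  have inj: "inj_on F {a..b}"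
    by (rule inj_onI) (metis F_less atLeastAtMost_iff less_irrefl linorder_less_linear)
  have F_cont: "continuous_on {a..b} F"
    using ab by (intro continuous_at_imp_continuous_on ballI DERIV_isCont[OF dF]) auto
  define \<psi> where "\<psi> = the_inv_into {a..b} F"
  have \<psi>F: "\<psi> (F x) = x" if "x \<in> {a..b}" for x
    using that inj by (simp add: \<psi>_def the_inv_into_f_f)
  have img: "\<exists>x\<in>{a..b}. F x = y" if "F a \<le> y" "y \<le> F b" for y
    using IVT'[of F a y b] that ab uv F_cont by auto
  have F\<psi>: "F (\<psi> y) = y" and \<psi>_in: "\<psi> y \<in> {a..b}" if y: "F a \<le> y" "y \<le> F b" for y
    using img[OF y] \<psi>F by auto
  have "continuous_on (F ` {a..b}) \<psi>"
    by (rule continuous_on_inv[OF F_cont]) (auto simp: \<psi>F)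
  then have \<psi>_cont: "continuous_on {F a<..<F b} \<psi>"
    by (rule continuous_on_subset) (force dest!: img[OF less_imp_le less_imp_le] simp: image_iff)
  have d\<psi>: "(\<psi> has_real_derivative G (\<psi> y)) (at y)" if y: "F a < y" "y < F b" for y
  proof -
    have "isCont \<psi> y"
      using \<psi>_cont y by (simp add: continuous_on_eq_continuous_at)
    moreover have "\<psi> y \<in> {a..b}" using \<psi>_in y by simp
    ultimately have "(\<psi> has_real_derivative inverse (1 / G (\<psi> y))) (at y)"
      using y F\<psi> ab G_pos[of "\<psi> y"]
      by (intro DERIV_inverse_function[of F _ _ _ "F a" "F b"] dF) auto
    then show ?thesis by simp
  qed
  have order: "F a < F u" "F u < F v" "F v < F b" using F_less ab uv by auto
  define T where "T = F v - F u"
  define \<phi> where "\<phi> t = \<psi> (F u + t)" for t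
  have range: "\<phi> t \<in> {u..v}" if t: "t \<in> {0..T}" for t
  proof -
    have y: "F a \<le> F u + t" "F u + t \<le> F b" "F u \<le> F u + t" "F u + t \<le> F v"
      using t order by (auto simp: T_def)
    have "\<not> \<phi> t < u" "\<not> v < \<phi> t"
      using F_less[of "\<phi> t" u] F_less[of v "\<phi> t"] F\<psi>[OF y(1,2)] \<psi>_in[OF y(1,2)] y ab uv
      by (auto simp: \<phi>_def)
    then show ?thesis by auto
  qed
  show ?thesis
  proof (rule that[of T \<phi>])
    show "0 < T" using order by (simp add: T_def)
    show "\<phi> 0 = u" "\<phi> T = v" using \<psi>F ab uv by (auto simp: \<phi>_def T_def)
    show "\<phi> t \<in> {u..v}" if "t \<in> {0..T}" for t using range that .
    show "(\<phi> has_real_derivative g (\<phi> t)) (at t within {0..T})" if t: "t \<in> {0..T}" for t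
    proof -
      have "(\<psi> has_real_derivative G (\<psi> (F u + t))) (at (F u + t))"
        using t order by (intro d\<psi>) (auto simp: T_def)
      then have "(\<phi> has_real_derivative G (\<phi> t)) (at t)"
        unfolding \<phi>_def add.commute[of "F u"] by (simp only: DERIV_shift)
      then show ?thesis
        using G_eq[OF range[OF t]] by (simp add: has_field_derivative_at_within)
    qed
  qed
qed

lemma autonomous_arc:
  fixes g :: "real \<Rightarrow> real"
  assumes "u \<noteq> v" and cont: "continuous_on (closed_segment u v) g"
    and sign: "\<And>x. x \<in> closed_segment u v \<Longrightarrow> 0 < (v - u) * g x"
  obtains T \<phi> where "0 < T" "\<phi> 0 = u" "\<phi> T = v"
    "\<And>t. t \<in> {0..T} \<Longrightarrow> \<phi> t \<in> closed_segment u v"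
    "\<And>t. t \<in> {0..T} \<Longrightarrow> (\<phi> has_real_derivative g (\<phi> t)) (at t within {0..T})"
proof (cases "u < v")
  case True
  then have seg: "closed_segment u v = {u..v}" by (simp add: closed_segment_eq_real_ivl)
  have "0 < g x" if "x \<in> {u..v}" for x
    using sign[of x] that True seg by (simp add: zero_less_mult_iff)
  then show ?thesis
    using autonomous_arc_increasing[OF True cont[unfolded seg]] that unfolding seg by blast
next
  case False
  with assms(1) have less: "- u < - v" by simp
  then have seg: "closed_segment u v = {v..u}" by (simp add: closed_segment_eq_real_ivl)
  have c: "continuous_on {- u..- v} (\<lambda>x. - g (- x))"
    by (intro continuous_on_minus continuous_on_compose2[OF cont[unfolded seg]] continuous_on_id) auto
  have s: "0 < - g (- x)" if "x \<in> {- u..- v}" for x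
    using sign[of "- x"] that less seg by (simp add: zero_less_mult_iff)
  obtain T \<phi> where *: "0 < T" "\<phi> 0 = - u" "\<phi> T = - v"
    "\<And>t. t \<in> {0..T} \<Longrightarrow> \<phi> t \<in> {- u..- v}"
    "\<And>t. t \<in> {0..T} \<Longrightarrow> (\<phi> has_real_derivative - g (- \<phi> t)) (at t within {0..T})"
    using autonomous_arc_increasing[OF less c s] by blast
  show ?thesis
  proof (rule that[of T "\<lambda>t. - \<phi> t"])
    show "- \<phi> t \<in> closed_segment u v" if "t \<in> {0..T}" for t
      using *(4)[OF that] seg by auto
    show "((\<lambda>t. - \<phi> t) has_real_derivative g (- \<phi> t)) (at t within {0..T})"
      if "t \<in> {0..T}" for t
      using DERIV_minus[OF *(5)[OF that]] by simp
  qed (use * in auto)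
qed

text \<open>
  These zeros are where an orbit of \<open>Y\<^sub>1\<close> meets the switching line again, in backward and in
  forward time; the sign in between says that the arc stays below the line.
\<close>

lemma first_zero:
  fixes h :: "real \<Rightarrow> real"
  assumes "u < w" "continuous_on {u..w} h" "h u < 0" "0 \<le> h w"
  obtains z where "u < z" "z \<le> w" "h z = 0" "\<And>s. u \<le> s \<Longrightarrow> s < z \<Longrightarrow> h s < 0"
proof -
  define S where "S = {u..w} \<inter> h -` {0..}"
  have "closed S"
    unfolding S_def by (rule continuous_closed_preimage[OF assms(2)]) auto
  moreover have "w \<in> S" using assms by (simp add: S_def)
  moreover have bdd: "bdd_below S" by (auto simp: S_def)
  ultimately have "Inf S \<in> S" by (intro closed_contains_Inf) auto
  then have z: "u \<le> Inf S" "Inf S \<le> w" "0 \<le> h (Inf S)" by (auto simp: S_def)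
  have neg: "h s < 0" if "u \<le> s" "s < Inf S" for s
  proof (rule ccontr)
    assume "\<not> h s < 0"
    then have "s \<in> S" using that z by (simp add: S_def)
    then show False using cInf_lower[of s S] bdd that by simp
  qed
  have "\<exists>x\<ge>u. x \<le> Inf S \<and> h x = 0"
    using z assms continuous_on_subset[OF assms(2), of "{u..Inf S}"] by (intro IVT') auto
  then obtain x where x: "u \<le> x" "x \<le> Inf S" "h x = 0" by blast
  then have "x = Inf S" using neg[of x] by force
  then show ?thesis using that[of x] x z neg assms by (cases "x = u") auto
qed

lemma last_zero:
  fixes h :: "real \<Rightarrow> real"
  assumes "w < u" "continuous_on {w..u} h" "h u < 0" "0 \<le> h w"
  obtains z where "w \<le> z" "z < u" "h z = 0" "\<And>s. z < s \<Longrightarrow> s \<le> u \<Longrightarrow> h s < 0"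
proof -
  have c: "continuous_on {- u..- w} (\<lambda>x. h (- x))"
    by (intro continuous_on_compose2[OF assms(2)] continuous_intros) auto
  obtain z where z: "- u < z" "z \<le> - w" "h (- z) = 0"
      "\<And>s. - u \<le> s \<Longrightarrow> s < z \<Longrightarrow> h (- s) < 0"
    using first_zero[of "- u" "- w", OF _ c] assms by auto
  have "h s < 0" if "- z < s" "s \<le> u" for s
    using z(4)[of "- s"] that by simp
  then show ?thesis using that[of "- z"] z by auto
qed

text \<open>
  Lyapunov's argument: the squared distance to \<open>r\<close> cannot grow while it is smaller than
  \<open>\<epsilon>\<^sup>2\<close>, and it starts at \<open>0\<close>. This is the uniqueness of solutions that is needed at a
  pseudo-equilibrium.
\<close>

lemma constant_at_attractor:
  fixes x v :: "real \<Rightarrow> real"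
  assumes "0 < \<epsilon>" and "x 0 = r"
    and der: "\<And>t. t \<in> {0..T} \<Longrightarrow> (x has_real_derivative v t) (at t within {0..T})"
    and sign: "\<And>t. t \<in> {0..T} \<Longrightarrow> \<bar>x t - r\<bar> < \<epsilon> \<Longrightarrow> (x t - r) * v t \<le> 0"
    and "t \<in> {0..T}"
  shows "x t = r"
proof (rule ccontr)
  assume "x t \<noteq> r"
  define u where "u s = (x s - r)\<^sup>2" for s
  define c where "c = min (u t) (\<epsilon>\<^sup>2)"
  have "0 < c" using \<open>x t \<noteq> r\<close> \<open>0 < \<epsilon>\<close> by (simp add: c_def u_def)
  have "0 < t" using \<open>x t \<noteq> r\<close> \<open>x 0 = r\<close> \<open>t \<in> {0..T}\<close> by (cases "t = 0") auto
  have "continuous_on {0..T} x"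
    using der DERIV_continuous continuous_on_eq_continuous_within by blast
  then have "continuous_on {0..t} x"
    by (rule continuous_on_subset) (use \<open>t \<in> {0..T}\<close> in auto)
  then have u_cont: "continuous_on {0..t} u"
    unfolding u_def by (intro continuous_intros)
  have "continuous_on {0..t} (\<lambda>s. u s - c)" "u 0 - c < 0" "0 \<le> u t - c"
    using u_cont \<open>0 < c\<close> \<open>x 0 = r\<close> by (auto intro!: continuous_intros simp: u_def c_def)
  from first_zero[OF \<open>0 < t\<close> this] obtain z
    where "0 < z" "z \<le> t" "u z - c = 0" "\<And>s. 0 \<le> s \<Longrightarrow> s < z \<Longrightarrow> u s - c < 0"
    by blast
  then have z: "0 < z" "z \<le> t" "u z = c" "\<And>s. 0 \<le> s \<Longrightarrow> s < z \<Longrightarrow> u s < c"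
    by simp_all
  have du: "(u has_real_derivative 2 * (x s - r) * v s) (at s)" if "0 < s" "s < z" for s
  proof -
    have "(x has_real_derivative v s) (at s)"
      using der[of s] that z \<open>t \<in> {0..T}\<close> by (simp add: at_within_Icc_at)
    then show ?thesis
      unfolding u_def by (auto intro!: derivative_eq_intros)
  qed
  have "\<exists>l s. 0 < s \<and> s < z \<and> DERIV u s :> l \<and> u z - u 0 = (z - 0) * l"
    using z du by (intro MVT continuous_on_subset[OF u_cont]) (auto simp: real_differentiable_def)
  then obtain l s where s: "0 < s" "s < z" "DERIV u s :> l" "u z - u 0 = z * l"
    by auto
  then have l: "l = 2 * (x s - r) * v s"
    using du DERIV_unique by blast
  have "(x s - r)\<^sup>2 < \<epsilon>\<^sup>2"
    using z(4)[of s] s by (simp add: c_def u_def)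
  then have "\<bar>x s - r\<bar> < \<epsilon>"
    using \<open>0 < \<epsilon>\<close> power2_less_imp_less[of "\<bar>x s - r\<bar>" \<epsilon>] by simp
  then have "(x s - r) * v s \<le> 0" using sign[of s] s z \<open>t \<in> {0..T}\<close> by simp
  then have "l \<le> 0" unfolding l mult.assoc by (rule mult_nonneg_nonpos[rotated]) simp
  then have "z * l \<le> 0" using \<open>0 < z\<close> by (simp add: mult_nonneg_nonpos)
  then show False using z s \<open>0 < c\<close> \<open>x 0 = r\<close> by (simp add: u_def)
qed

section \<open>Concatenating local trajectories\<close>

definition step ::
  "(plane \<Rightarrow> real) \<Rightarrow> vfield \<Rightarrow> vfield \<Rightarrow> plane \<Rightarrow> plane \<Rightarrow> real \<Rightarrow> bool" where
  "step f X Y p q T \<longleftrightarrow> 0 < T \<and> (\<exists>\<phi>. local_trajectory f X Y p {0..T} \<phi> \<and> \<phi> T = q)"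

text \<open>
  The relation is a parameter because itineraries are followed in both time directions: for
  \<open>step f X Y\<close> they are positive trajectories, for its converse negative ones.
\<close>

definition itinerary :: "('a \<Rightarrow> 'a \<Rightarrow> real \<Rightarrow> bool) \<Rightarrow> (nat \<Rightarrow> 'a) \<Rightarrow> (nat \<Rightarrow> real) \<Rightarrow> bool" where
  "itinerary R P T \<longleftrightarrow>
     (\<forall>n. R (P n) (P (Suc n)) (T n)) \<and> filterlim (\<lambda>n. \<Sum>i<n. T i) at_top sequentially"

definition endless :: "('a \<Rightarrow> 'a \<Rightarrow> real \<Rightarrow> bool) \<Rightarrow> 'a \<Rightarrow> bool" where
  "endless R p \<longleftrightarrow> (\<exists>P T. itinerary R P T \<and> P 0 = p)"

abbreviation (input) step_back ::
  "(plane \<Rightarrow> real) \<Rightarrow> vfield \<Rightarrow> vfield \<Rightarrow> plane \<Rightarrow> plane \<Rightarrow> real \<Rightarrow> bool" where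
  "step_back f X Y \<equiv> \<lambda>p q T. step f X Y q p T"

lemma itinerary_prepend:
  assumes "R p (P 0) t" "itinerary R P T"
  shows "itinerary R (case_nat p P) (case_nat t T)"
proof -
  have "R (case_nat p P n) (case_nat p P (Suc n)) (case_nat t T n)" for n
    using assms by (cases n) (auto simp: itinerary_def)
  moreover have "filterlim (\<lambda>n. \<Sum>i<n. case_nat t T i) at_top sequentially"
  proof -
    have "(\<Sum>i<Suc n. case_nat t T i) = t + (\<Sum>i<n. T i)" for n
      by (subst sum.lessThan_Suc_shift) simp
    moreover have "filterlim (\<lambda>n. t + (\<Sum>i<n. T i)) at_top sequentially"
      by (rule filterlim_tendsto_add_at_top[OF tendsto_const])
        (use assms(2) in \<open>simp add: itinerary_def\<close>)
    ultimately show ?thesis by (subst filterlim_sequentially_Suc[symmetric]) simp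
  qed
  ultimately show ?thesis by (simp add: itinerary_def)
qed

lemma endless_prepend: "R p q t \<Longrightarrow> endless R q \<Longrightarrow> endless R p"
proof -
  assume "R p q t" "endless R q"
  then obtain P T where "itinerary R P T" "P 0 = q" by (auto simp: endless_def)
  with \<open>R p q t\<close> have "itinerary R (case_nat p P) (case_nat t T)"
    by (intro itinerary_prepend) auto
  then show ?thesis
    unfolding endless_def by (intro exI[of _ "case_nat p P"] exI[of _ "case_nat t T"]) simp
qed

lemma endless_if_steps_last:
  assumes "0 < \<delta>" "p \<in> G"
    and next_step: "\<And>p. p \<in> G \<Longrightarrow> \<exists>q\<in>G. \<exists>t\<ge>\<delta>. R p q t"
  shows "endless R p"
proof -
  obtain P where P: "P 0 = p" "\<And>n. P n \<in> G" "\<And>n. \<exists>t\<ge>\<delta>. R (P n) (P (Suc n)) t"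
    using dependent_nat_choice[of "\<lambda>n x. x \<in> G \<and> (n = 0 \<longrightarrow> x = p)" "\<lambda>n x y. \<exists>t\<ge>\<delta>. R x y t"]
      assms by (metis nat.distinct(1))
  then obtain T where T: "\<And>n. \<delta> \<le> T n" "\<And>n. R (P n) (P (Suc n)) (T n)" by metis
  have linear: "filterlim (\<lambda>n. real n * \<delta>) at_top sequentially"
    using \<open>0 < \<delta>\<close> by (intro filterlim_at_top_mult_tendsto_pos[OF tendsto_const] filterlim_real_sequentially)
  have "real n * \<delta> \<le> (\<Sum>i<n. T i)" for n
    using sum_bounded_below[of "{..<n}" \<delta> T] T by simp
  then have "filterlim (\<lambda>n. \<Sum>i<n. T i) at_top sequentially"
    by (intro filterlim_at_top_mono[OF linear] always_eventually allI)
  then show ?thesis unfolding endless_def itinerary_def using P T by blast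
qed

lemma global_trajectory_through:
  assumes fwd: "itinerary (step f X Y) Pf Tf" and bwd: "itinerary (step_back f X Y) Pb Tb"
    and "Pf 0 = p" "Pb 0 = p"
  shows "\<exists>\<Gamma>. global_trajectory f X Y p \<Gamma> \<and> range Pf \<subseteq> \<Gamma> \<and> range Pb \<subseteq> \<Gamma>"
proof -
  define P where "P i = (if 0 \<le> i then Pf (nat i) else Pb (nat (- i)))" for i :: int
  define \<tau> where "\<tau> i = (if 0 \<le> i then \<Sum>j<nat i. Tf j else - (\<Sum>j<nat (- i). Tb j))" for i :: int
  have "step f X Y (P i) (P (i + 1)) (\<tau> (i + 1) - \<tau> i)" for i
  proof (cases "0 \<le> i")
    case True
    then have "nat (i + 1) = Suc (nat i)" by simp
    then show ?thesis using fwd True by (simp add: P_def \<tau>_def itinerary_def)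
  next
    case False
    define m where "m = nat (- (i + 1))"
    have m: "nat (- i) = Suc m" "i + 1 = - int m" using False by (auto simp: m_def)
    have "P (i + 1) = Pb m" "\<tau> (i + 1) = - (\<Sum>j<m. Tb j)"
      using assms(3,4) by (auto simp: P_def \<tau>_def m(2))
    then show ?thesis using bwd False m(1) by (simp add: P_def \<tau>_def itinerary_def)
  qed
  then obtain s where s: "\<And>i. \<tau> i < \<tau> (i + 1)"
      "\<And>i. local_trajectory f X Y (P i) {0..\<tau> (i + 1) - \<tau> i} (s i)"
      "\<And>i. s i (\<tau> (i + 1) - \<tau> i) = P (i + 1)"
    unfolding step_def by (metis diff_gt_0_iff_gt)
  define \<sigma> where "\<sigma> i t = s i (t - \<tau> i)" for i t
  have chain: "trajectory_chain f X Y UNIV \<tau> P \<sigma>"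
    unfolding trajectory_chain_def \<sigma>_def using s by simp
  have Tf: "filterlim (\<lambda>n. \<Sum>j<n. Tf j) at_top sequentially"
    and Tb: "filterlim (\<lambda>n. \<Sum>j<n. Tb j) at_top sequentially"
    using fwd bwd by (simp_all add: itinerary_def)
  have "filterlim nat sequentially at_top"
    unfolding filterlim_at_top
  proof
    fix Z show "eventually (\<lambda>i. Z \<le> nat i) at_top"
      using eventually_ge_at_top[of "int Z"] by eventually_elim simp
  qed
  from filterlim_compose[OF Tf this] have top: "filterlim \<tau> at_top at_top"
    by (rule filterlim_cong[OF refl refl, THEN iffD1, rotated])
      (rule eventually_mono[OF eventually_ge_at_top[of 0]], auto simp: \<tau>_def)
  have "filterlim (\<lambda>i. nat (- i)) sequentially at_bot"
    unfolding filterlim_at_top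
  proof
    fix Z show "eventually (\<lambda>i. Z \<le> nat (- i)) at_bot"
      using eventually_le_at_bot[of "- int Z"] by eventually_elim simp
  qed
  from filterlim_compose[OF Tb this] have "filterlim (\<lambda>i. - (\<Sum>j<nat (- i). Tb j)) at_bot at_bot"
    by (simp add: filterlim_uminus_at_top)
  then have bot: "filterlim \<tau> at_bot at_bot"
    by (rule filterlim_cong[OF refl refl, THEN iffD1, rotated])
      (rule eventually_mono[OF eventually_le_at_bot[of 0]], auto simp: \<tau>_def)
  have vertex: "P i \<in> chain_image UNIV \<tau> \<sigma>" for i
  proof -
    have "\<sigma> i (\<tau> i) = P i" using s(2)[of i] by (simp add: \<sigma>_def local_trajectory_def)
    moreover have "\<sigma> i (\<tau> i) \<in> chain_image UNIV \<tau> \<sigma>"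
      unfolding chain_image_def using s(1)[of i]
      by (intro UN_I[of i] CollectI exI[of _ "\<tau> i"]) auto
    ultimately show ?thesis by simp
  qed
  have "Pf n \<in> chain_image UNIV \<tau> \<sigma>" for n
    using vertex[of "int n"] by (simp add: P_def)
  moreover have "Pb n \<in> chain_image UNIV \<tau> \<sigma>" for n
    using vertex[of "- int n"] assms(3,4) by (cases "n = 0") (auto simp: P_def)
  moreover have "global_trajectory f X Y p (chain_image UNIV \<tau> \<sigma>)"
    unfolding global_trajectory_def using chain top bot assms(3) by (force simp: P_def)
  ultimately show ?thesis by blast
qed

text \<open>
  Invariance refers to whole bi-infinite trajectories, so that it moves membership along a step
  in both directions as soon as the step extends to one of them.
\<close>

lemma Z_invariant_step_iff:
  assumes inv: "Z_invariant f X Y N" and pq: "step f X Y p q t"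
    and fwd: "endless (step f X Y) q" and bwd: "endless (step_back f X Y) p"
  shows "p \<in> N \<longleftrightarrow> q \<in> N"
proof -
  obtain Pf Tf where f: "itinerary (step f X Y) Pf Tf" "Pf 0 = q"
    using fwd by (auto simp: endless_def)
  obtain Pb Tb where b: "itinerary (step_back f X Y) Pb Tb" "Pb 0 = p"
    using bwd by (auto simp: endless_def)
  have "itinerary (step f X Y) (case_nat p Pf) (case_nat t Tf)"
    using f pq by (intro itinerary_prepend) auto
  from global_trajectory_through[OF this b(1), of p] obtain \<Gamma>
    where \<Gamma>: "global_trajectory f X Y p \<Gamma>" "range (case_nat p Pf) \<subseteq> \<Gamma>" using b by auto
  have "case_nat p Pf (Suc 0) \<in> \<Gamma>" using \<Gamma>(2) by blast
  then have 1: "q \<in> \<Gamma>" using f by simp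
  have "itinerary (step_back f X Y) (case_nat q Pb) (case_nat t Tb)"
    using b pq by (intro itinerary_prepend) auto
  from global_trajectory_through[OF f(1) this, of q] obtain \<Delta>
    where \<Delta>: "global_trajectory f X Y q \<Delta>" "range (case_nat q Pb) \<subseteq> \<Delta>" using f by auto
  have "case_nat q Pb (Suc 0) \<in> \<Delta>" using \<Delta>(2) by blast
  then have 2: "p \<in> \<Delta>" using b by simp
  show ?thesis using 1 2 \<Gamma>(1) \<Delta>(1) inv by (auto simp: Z_invariant_def)
qed

section \<open>The switching line of \<open>Z\<^sub>1\<close>\<close>

text \<open>
  The parabola \<open>y = 12 + x - x\<^sup>2\<close> and the graph of the quartic bound \<open>\<Lambda>\<^sub>1\<close>; the orbits of
  \<open>Y\<^sub>1\<close> are the vertical translates of this graph, run through from right to left.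
\<close>

definition quartic :: "real \<Rightarrow> real" where
  "quartic x = (- 4 + x) * (- 2 + x)\<^sup>2 * (3 + x)"

text \<open>
  The two local minima of the quartic, which are the invisible tangencies of \<open>Y\<^sub>1\<close>. Its local
  maximum \<open>2\<close> is the visible one.
\<close>

definition fold_left :: real where
  "fold_left = (7 - sqrt 401) / 8"

definition fold_right :: real where
  "fold_right = (7 + sqrt 401) / 8"

text \<open>The Lie derivative of \<open>f\<^sub>1\<close> along \<open>Y\<^sub>1\<close>, factored to make its sign readable.\<close>

definition Y1_slope :: "real \<Rightarrow> real" where
  "Y1_slope x = - 4 * (x - 2) * (x - fold_left) * (x - fold_right)"

lemma fold_bounds:
  "- 163 / 100 < fold_left" "fold_left < - 16 / 10" "337 / 100 < fold_right" "fold_right < 338 / 100"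
proof -
  have "20 < sqrt 401" by (rule real_less_rsqrt) simp
  moreover have "sqrt 401 < 501 / 25" by (rule real_less_lsqrt) (auto simp: power2_eq_square)
  ultimately show "- 163 / 100 < fold_left" "fold_left < - 16 / 10" "337 / 100 < fold_right"
    "fold_right < 338 / 100" by (auto simp: fold_left_def fold_right_def)
qed

lemma Y1_slope_eq: "Y1_slope x = - ((- 2 + x) * (- 22 + x * (- 7 + 4 * x)))"
proof -
  have "(x - fold_left) * (x - fold_right) = (x - 7 / 8)\<^sup>2 - (sqrt 401)\<^sup>2 / 64"
    unfolding fold_left_def fold_right_def by (simp add: field_simps power2_eq_square)
  then have *: "4 * ((x - fold_left) * (x - fold_right)) = - 22 + x * (- 7 + 4 * x)"
    by (simp add: field_simps power2_eq_square)
  have "Y1_slope x = - ((x - 2) * (4 * ((x - fold_left) * (x - fold_right))))"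
    by (simp add: Y1_slope_def algebra_simps)
  then show ?thesis unfolding * by simp
qed

lemma Y1_slope_sign:
  "x < fold_left \<Longrightarrow> 0 < Y1_slope x"
  "fold_left < x \<Longrightarrow> x < 2 \<Longrightarrow> Y1_slope x < 0"
  "2 < x \<Longrightarrow> x < fold_right \<Longrightarrow> 0 < Y1_slope x"
  "fold_right < x \<Longrightarrow> Y1_slope x < 0"
  using fold_bounds by (auto simp: Y1_slope_def zero_less_mult_iff mult_less_0_iff)

lemma Y1_slope_eq_0_iff: "Y1_slope x = 0 \<longleftrightarrow> x = 2 \<or> x = fold_left \<or> x = fold_right"
  by (auto simp: Y1_slope_def)

lemma quartic_deriv: "(quartic has_real_derivative - Y1_slope x) (at x within A)"
  unfolding quartic_def[abs_def] Y1_slope_eq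
  by (auto intro!: derivative_eq_intros simp: algebra_simps power2_eq_square)

lemma quartic_less_decreasing:
  assumes "x < y" "y \<le> fold_left \<or> 2 \<le> x \<and> y \<le> fold_right"
  shows "quartic y < quartic x"
proof (rule DERIV_neg_imp_decreasing_open[OF assms(1)])
  show "\<exists>d. (quartic has_real_derivative d) (at z) \<and> d < 0" if "x < z" "z < y" for z
    using assms that by (intro exI[of _ "- Y1_slope z"] conjI quartic_deriv) (auto intro: Y1_slope_sign)
qed (auto intro!: DERIV_continuous_on quartic_deriv)

lemma quartic_less_increasing:
  assumes "x < y" "fold_left \<le> x \<and> y \<le> 2 \<or> fold_right \<le> x"
  shows "quartic x < quartic y"
proof (rule DERIV_pos_imp_increasing_open[OF assms(1)])
  show "\<exists>d. (quartic has_real_derivative d) (at z) \<and> 0 < d" if "x < z" "z < y" for z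
    using assms that by (intro exI[of _ "- Y1_slope z"] conjI quartic_deriv) (auto intro: Y1_slope_sign)
qed (auto intro!: DERIV_continuous_on quartic_deriv)

lemma quartic_nonpos: "- 3 \<le> x \<Longrightarrow> x \<le> 4 \<Longrightarrow> quartic x \<le> 0"
  by (auto simp: quartic_def mult_nonpos_nonneg)

lemma quartic_roots [simp]: "quartic (- 3) = 0" "quartic 2 = 0" "quartic 4 = 0"
  by (simp_all add: quartic_def)

lemma gradient_f1: "gradient f1 q = (0, 1)"
proof -
  have f1: "f1 = snd" by (auto simp: f1_def)
  have eq: "(\<lambda>h. h \<bullet> (0, 1)) = (snd :: plane \<Rightarrow> real)" by (auto simp: inner_prod_def)
  have "GDERIV f1 q :> (0, 1)"
    unfolding gderiv_def f1 eq by (intro bounded_linear_imp_has_derivative bounded_linear_snd)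
  moreover have "D = (0, 1)" if "GDERIV f1 q :> D" for D
  proof -
    have "(\<lambda>h. h \<bullet> D) = snd"
      using has_derivative_unique[OF that[unfolded gderiv_def]] calculation
      unfolding gderiv_def eq by blast
    then have "(1, 0) \<bullet> D = 0" "(0, 1) \<bullet> D = 1" by (metis snd_conv)+
    then show ?thesis by (cases D) simp
  qed
  ultimately show ?thesis unfolding gradient_def by (rule the_equality)
qed

lemma lie_deriv_X1: "lie_deriv f1 X1 (x, y) = 1 - 2 * x"
  by (simp add: lie_deriv_def gradient_f1 X1_def)

lemma lie_deriv_Y1: "lie_deriv f1 Y1 (x, y) = Y1_slope x"
  by (simp add: lie_deriv_def gradient_f1 Y1_def Y1_slope_eq)

lemma f1_regions:
  "(x, y) \<in> switching_manifold f1 \<longleftrightarrow> y = 0"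
  "(x, y) \<in> upper_region f1 \<longleftrightarrow> 0 \<le> y"
  "(x, y) \<in> lower_region f1 \<longleftrightarrow> y \<le> 0"
  by (auto simp: switching_manifold_def upper_region_def lower_region_def f1_def)

lemma Z1_regions:
  "(x, y) \<in> sewing_up f1 X1 Y1 \<longleftrightarrow> y = 0 \<and> x < fold_left"
  "(x, y) \<in> sewing_down f1 X1 Y1 \<longleftrightarrow> y = 0 \<and> (1 / 2 < x \<and> x < 2 \<or> fold_right < x)"
  "(x, y) \<in> escaping_region f1 X1 Y1 \<longleftrightarrow> y = 0 \<and> fold_left < x \<and> x < 1 / 2"
  "(x, y) \<in> sliding_region f1 X1 Y1 \<longleftrightarrow> y = 0 \<and> 2 < x \<and> x < fold_right"
  "(x, y) \<in> tangency_points f1 X1 Y1 \<longleftrightarrow>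
     y = 0 \<and> (x = fold_left \<or> x = 1 / 2 \<or> x = 2 \<or> x = fold_right)"
proof -
  have pos: "0 < Y1_slope x \<longleftrightarrow> x < fold_left \<or> 2 < x \<and> x < fold_right"
   and neg: "Y1_slope x < 0 \<longleftrightarrow> fold_left < x \<and> x < 2 \<or> fold_right < x"
    using Y1_slope_sign[of x] Y1_slope_eq_0_iff[of x] fold_bounds
    by (cases "x < fold_left"; cases "x < 2"; cases "x < fold_right"; force)+
  note defs = sewing_up_def sewing_down_def escaping_region_def sliding_region_def
    tangency_points_def f1_regions lie_deriv_X1 lie_deriv_Y1 pos neg Y1_slope_eq_0_iff
  show "(x, y) \<in> sewing_up f1 X1 Y1 \<longleftrightarrow> y = 0 \<and> x < fold_left"
    "(x, y) \<in> sewing_down f1 X1 Y1 \<longleftrightarrow> y = 0 \<and> (1 / 2 < x \<and> x < 2 \<or> fold_right < x)"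
    "(x, y) \<in> escaping_region f1 X1 Y1 \<longleftrightarrow> y = 0 \<and> fold_left < x \<and> x < 1 / 2"
    "(x, y) \<in> sliding_region f1 X1 Y1 \<longleftrightarrow> y = 0 \<and> 2 < x \<and> x < fold_right"
    "(x, y) \<in> tangency_points f1 X1 Y1 \<longleftrightarrow>
     y = 0 \<and> (x = fold_left \<or> x = 1 / 2 \<or> x = 2 \<or> x = fold_right)"
    using fold_bounds by (auto simp: defs)
qed

lemma regular_tangencies_Z1: "regular_tangencies f1 X1 Y1 = tangency_points f1 X1 Y1"
proof -
  have "q \<notin> singular_tangencies f1 X1 Y1" for q
    using fold_bounds by (cases q)
      (auto simp: singular_tangencies_def invisible_X_tangency_def invisible_Y_tangency_def
        lie_deriv_X1 lie_deriv_Y1 Y1_slope_eq_0_iff)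
  then show ?thesis by (auto simp: regular_tangencies_def)
qed

lemma singular_tangencies_Z1: "singular_tangencies f1 X1 Y1 = {}"
  using regular_tangencies_Z1 by (auto simp: regular_tangencies_def singular_tangencies_def)

section \<open>The sliding and escaping vector field of \<open>Z\<^sub>1\<close>\<close>

text \<open>The horizontal component of \<open>Z\<^sup>\<Sigma>\<close>; its vertical component is zero.\<close>

definition slide :: "real \<Rightarrow> real" where
  "slide x = (Y1_slope x + (1 - 2 * x)) / (Y1_slope x - (1 - 2 * x))"

definition slide_set :: "real set" where
  "slide_set = {fold_left..1 / 2} \<union> {2..fold_right}"

lemma slide_denominator:
  "x \<in> {fold_left..1 / 2} \<Longrightarrow> Y1_slope x - (1 - 2 * x) < 0"
  "x \<in> {2..fold_right} \<Longrightarrow> 2 * x - 1 \<le> Y1_slope x - (1 - 2 * x)"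
proof -
  show "Y1_slope x - (1 - 2 * x) < 0" if "x \<in> {fold_left..1 / 2}"
    using that Y1_slope_sign(2)[of x] Y1_slope_eq_0_iff[of x] fold_bounds
    by (cases "x = fold_left") auto
  show "2 * x - 1 \<le> Y1_slope x - (1 - 2 * x)" if "x \<in> {2..fold_right}"
    using that Y1_slope_sign(3)[of x] Y1_slope_eq_0_iff[of x]
    by (cases "x = 2 \<or> x = fold_right") auto
qed

lemma slide_denominator_nonzero: "x \<in> slide_set \<Longrightarrow> Y1_slope x - (1 - 2 * x) \<noteq> 0"
  using slide_denominator[of x] by (auto simp: slide_set_def)

lemma continuous_on_slide: "continuous_on slide_set slide"
  unfolding slide_def[abs_def] Y1_slope_def[abs_def]
  by (intro continuous_intros) (use slide_denominator_nonzero in \<open>auto simp: Y1_slope_def\<close>)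

lemma sliding_vf_f1:
  assumes F: "F (x, 0) = (c, \<alpha>)" and G: "G (x, 0) = (- c, \<beta>)" and "\<alpha> < 0" "0 < \<beta>"
  shows "sliding_vf f1 F G (x, 0) = (c * (\<beta> + \<alpha>) / (\<beta> - \<alpha>), 0)"
proof -
  define m :: plane where "m = (x + c * (\<beta> + \<alpha>) / (\<beta> - \<alpha>), 0)"
  have "\<beta> - \<alpha> > 0" using assms by simp
  have "(THE m. m \<in> closed_segment ((x, 0) + F (x, 0)) ((x, 0) + G (x, 0)) \<and>
      gradient f1 (x, 0) \<bullet> (m - (x, 0)) = 0) = m"
  proof (rule the_equality)
    define u where "u = - \<alpha> / (\<beta> - \<alpha>)"
    have "c * (\<beta> + \<alpha>) / (\<beta> - \<alpha>) = c * (1 - 2 * u)" "(1 - u) * \<alpha> + u * \<beta> = 0"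
      using \<open>\<beta> - \<alpha> > 0\<close> by (auto simp: u_def field_simps)
    then have "m = (1 - u) *\<^sub>R (x + c, \<alpha>) + u *\<^sub>R (x + - c, \<beta>)"
      by (simp add: m_def algebra_simps)
    moreover have "0 \<le> u" "u \<le> 1"
      using assms by (auto simp: u_def field_simps)
    ultimately have "m \<in> closed_segment (x + c, \<alpha>) (x + - c, \<beta>)"
      unfolding closed_segment_def by blast
    then show "m \<in> closed_segment ((x, 0) + F (x, 0)) ((x, 0) + G (x, 0)) \<and>
        gradient f1 (x, 0) \<bullet> (m - (x, 0)) = 0"
      by (simp add: F G gradient_f1 m_def)
  next
    fix n assume "n \<in> closed_segment ((x, 0) + F (x, 0)) ((x, 0) + G (x, 0)) \<and>
        gradient f1 (x, 0) \<bullet> (n - (x, 0)) = 0"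
    then obtain u where n: "n = (1 - u) *\<^sub>R (x + c, \<alpha>) + u *\<^sub>R (x + - c, \<beta>)" and "snd n = 0"
      by (cases n) (auto simp: F G gradient_f1 closed_segment_def)
    then have "(1 - u) * \<alpha> + u * \<beta> = 0" by simp
    then have "c * (\<beta> + \<alpha>) / (\<beta> - \<alpha>) = c * (1 - 2 * u)"
    proof -
      have "(1 - 2 * u) * (\<beta> - \<alpha>) = \<beta> + \<alpha> - 2 * ((1 - u) * \<alpha> + u * \<beta>)"
        by (simp add: algebra_simps)
      then have "\<beta> + \<alpha> = (1 - 2 * u) * (\<beta> - \<alpha>)"
        using \<open>(1 - u) * \<alpha> + u * \<beta> = 0\<close> by simp
      then show ?thesis using \<open>\<beta> - \<alpha> > 0\<close> by simp
    qed
    then show "n = m" using \<open>snd n = 0\<close> n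
      by (intro prod_eqI) (simp_all add: m_def algebra_simps)
  qed
  then show ?thesis by (simp add: sliding_vf_def m_def)
qed

lemma sigma_vf_open_Z1:
  assumes "x \<in> {fold_left<..<1 / 2} \<union> {2<..<fold_right}"
  shows "sigma_vf_open f1 X1 Y1 (x, 0) = (slide x, 0)"
proof -
  have X: "X1 (x, 0) = (1, 1 - 2 * x)" and Y: "Y1 (x, 0) = (- 1, Y1_slope x)"
    by (simp_all add: X1_def Y1_def Y1_slope_eq)
  show ?thesis
  proof (cases "2 < x")
    case True
    then have "(x, 0) \<in> sliding_region f1 X1 Y1" using assms by (auto simp: Z1_regions)
    moreover have "sliding_vf f1 X1 Y1 (x, 0) = (1 * (Y1_slope x + (1 - 2 * x)) / (Y1_slope x - (1 - 2 * x)), 0)"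
      using True assms by (intro sliding_vf_f1 X Y Y1_slope_sign) auto
    ultimately show ?thesis by (simp add: sigma_vf_open_def slide_def)
  next
    case False
    then have "(x, 0) \<notin> sliding_region f1 X1 Y1" by (auto simp: Z1_regions)
    moreover have "sliding_vf f1 (\<lambda>p. - X1 p) (\<lambda>p. - Y1 p) (x, 0) =
        (- 1 * (- Y1_slope x + - (1 - 2 * x)) / (- Y1_slope x - - (1 - 2 * x)), 0)"
      using False assms Y1_slope_sign(2)[of x] fold_bounds by (intro sliding_vf_f1) (auto simp: X Y)
    moreover have "- (- 1 * (- Y1_slope x + - (1 - 2 * x)) / (- Y1_slope x - - (1 - 2 * x))) = slide x"
    proof -
      have "- 1 * (- Y1_slope x + - (1 - 2 * x)) = Y1_slope x + (1 - 2 * x)"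
        "- Y1_slope x - - (1 - 2 * x) = - (Y1_slope x - (1 - 2 * x))" by simp_all
      then show ?thesis by (simp only: slide_def divide_minus_right minus_minus)
    qed
    ultimately show ?thesis by (simp add: sigma_vf_open_def escaping_vf_def)
  qed
qed

lemma islimpt_open_interval:
  fixes x :: real
  assumes "a < b" "a \<le> x" "x \<le> b"
  shows "x islimpt {a<..<b}"
proof -
  consider "x = a" | "x = b" | "x \<in> interior {a<..<b}" using assms by fastforce
  then show ?thesis
    using assms islimpt_greaterThanLessThan1 islimpt_greaterThanLessThan2 interior_limit_point
    by cases blast+
qed

text \<open>
  Both fields have horizontal component of modulus \<open>1\<close> and only one of them is tangent at each
  fold, so the denominator of \<open>slide\<close> survives there: this is why \<open>Z\<^sup>\<Sigma>\<close> extends to all four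
  tangency points.
\<close>

lemma sigma_Z1:
  shows sigma_domain_Z1: "p \<in> sigma_domain f1 X1 Y1 \<longleftrightarrow> (\<exists>x\<in>slide_set. p = (x, 0))"
    and sigma_vf_Z1: "x \<in> slide_set \<Longrightarrow> sigma_vf f1 X1 Y1 (x, 0) = (slide x, 0)"
proof -
  define U where "U = {fold_left<..<1 / 2} \<union> {2<..<fold_right}"
  define R where "R = escaping_region f1 X1 Y1 \<union> sliding_region f1 X1 Y1"
  have R: "R = (\<lambda>x. (x, 0)) ` U"
    by (auto simp: R_def U_def Z1_regions image_iff)
  have "U \<subseteq> slide_set" by (auto simp: U_def slide_set_def)
  have limit: "(x, 0) islimpt R \<and> (sigma_vf_open f1 X1 Y1 \<longlongrightarrow> (slide x, 0)) (at (x, 0) within R)"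
    if x: "x \<in> slide_set" for x
  proof
    have "x islimpt {fold_left<..<1 / 2} \<or> x islimpt {2<..<fold_right}"
      using x fold_bounds islimpt_open_interval unfolding slide_set_def by auto
    then have "x islimpt U" unfolding U_def using islimpt_subset by blast
    then show "(x, 0) islimpt R"
      unfolding R by (rule islimpt_isCont_image) (auto intro!: continuous_intros simp: eventually_at_filter)
    have "(slide \<longlongrightarrow> slide x) (at x within slide_set)"
      using continuous_on_slide x by (auto simp: continuous_on_def)
    moreover have "filterlim fst (at x within slide_set) (at (x, 0::real) within R)"
      using \<open>U \<subseteq> slide_set\<close> unfolding filterlim_at R
      by (auto intro!: tendsto_eq_intros always_eventually simp: eventually_at_filter)
    ultimately have "((\<lambda>p. slide (fst p)) \<longlongrightarrow> slide x) (at (x, 0::real) within R)"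
      by (rule filterlim_compose)
    then have "((\<lambda>p. (slide (fst p), 0)) \<longlongrightarrow> (slide x, 0)) (at (x, 0::real) within R)"
      by (intro tendsto_intros)
    then show "(sigma_vf_open f1 X1 Y1 \<longlongrightarrow> (slide x, 0)) (at (x, 0) within R)"
    proof (rule Lim_transform_eventually)
      show "\<forall>\<^sub>F p in at (x, 0) within R. (slide (fst p), 0) = sigma_vf_open f1 X1 Y1 p"
        unfolding eventually_at_filter
        by (rule always_eventually) (auto simp: R U_def sigma_vf_open_Z1)
    qed
  qed
  have tang: "x \<in> slide_set \<longleftrightarrow> x \<in> U \<or> (x, 0) \<in> tangency_points f1 X1 Y1" for x
    using fold_bounds by (auto simp: slide_set_def U_def Z1_regions)
  show "p \<in> sigma_domain f1 X1 Y1 \<longleftrightarrow> (\<exists>x\<in>slide_set. p = (x, 0))" for p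
  proof -
    obtain x y where p: "p = (x, y)" by (cases p)
    have "p \<in> sigma_domain f1 X1 Y1 \<longleftrightarrow> p \<in> R \<or> p \<in> sigma_limit_tangencies f1 X1 Y1"
      by (auto simp: sigma_domain_def R_def)
    also have "\<dots> \<longleftrightarrow> p \<in> R \<or> p \<in> tangency_points f1 X1 Y1"
    proof -
      have "p \<in> sigma_limit_tangencies f1 X1 Y1" if "p \<in> tangency_points f1 X1 Y1"
        using limit[of x] tang[of x] that by (auto simp: sigma_limit_tangencies_def p Z1_regions R_def)
      then show ?thesis by (auto simp: sigma_limit_tangencies_def)
    qed
    also have "\<dots> \<longleftrightarrow> (\<exists>x\<in>slide_set. p = (x, 0))"
      using tang[of x] by (auto simp: R p image_iff Z1_regions)
    finally show ?thesis .
  qed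
  show "sigma_vf f1 X1 Y1 (x, 0) = (slide x, 0)" if x: "x \<in> slide_set" for x
  proof (cases "(x, 0) \<in> R")
    case True
    then show ?thesis using sigma_vf_open_Z1[of x] by (auto simp: sigma_vf_def R_def[symmetric] R U_def)
  next
    case False
    have "Lim (at (x, 0) within R) (sigma_vf_open f1 X1 Y1) = (slide x, 0)"
      using limit[OF x] by (intro tendsto_Lim) (auto simp: trivial_limit_within)
    then show ?thesis using False by (simp add: sigma_vf_def R_def)
  qed
qed

section \<open>Arcs of \<open>Z\<^sub>1\<close>\<close>

lemma integral_arc_singleton: "integral_arc F D {t} \<phi> \<longleftrightarrow> \<phi> t \<in> D"
  by (auto simp: integral_arc_def has_vector_derivative_def has_derivative_within_singleton_iff bounded_linear_scaleR_left)

text \<open>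
  Pieces of trajectories are followed forward only, so the part of a local trajectory for
  non-positive times degenerates to a point and constrains nothing.
\<close>

lemma local_trajectory_Z1:
  assumes "0 \<le> T"
  shows "local_trajectory f1 X1 Y1 (x, y) {0..T} \<phi> \<longleftrightarrow> \<phi> 0 = (x, y) \<and>
    (if 0 < y \<or> y = 0 \<and> x < fold_left then X_arc f1 X1 {0..T} \<phi>
     else if y < 0 \<or> 1 / 2 < x \<and> x < 2 \<or> fold_right < x then Y_arc f1 Y1 {0..T} \<phi>
     else if 2 < x \<and> x < fold_right then sigma_arc f1 X1 Y1 {0..T} \<phi>
     else some_arc f1 X1 Y1 {0..T} \<phi>)"
proof (cases "\<phi> 0 = (x, y)")
  case False
  then show ?thesis by (simp add: local_trajectory_def)
next
  case True
  have times: "{0..T} \<inter> {..0} = {0}" "{0..T} \<inter> {0..} = {0..T}" using assms by auto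
  have singleton: "X_arc f1 X1 {0} \<phi> \<longleftrightarrow> 0 \<le> y" "Y_arc f1 Y1 {0} \<phi> \<longleftrightarrow> y \<le> 0"
      "sigma_arc f1 X1 Y1 {0} \<phi> \<longleftrightarrow> (x, y) \<in> sigma_domain f1 X1 Y1"
      "some_arc f1 X1 Y1 {0} \<phi>"
    using True
    by (auto simp: X_arc_def Y_arc_def sigma_arc_def some_arc_def integral_arc_singleton f1_regions)
  have "is_interval {0..T}" "0 \<in> {0..T}" using assms by auto
  consider "0 < y" | "y < 0" | "y = 0" "x < fold_left" | "y = 0" "x = fold_left"
    | "y = 0" "fold_left < x" "x < 1 / 2" | "y = 0" "x = 1 / 2" | "y = 0" "1 / 2 < x" "x < 2"
    | "y = 0" "x = 2" | "y = 0" "2 < x" "x < fold_right" | "y = 0" "x = fold_right"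
    | "y = 0" "fold_right < x"
    using linorder_less_linear[of y 0] linorder_less_linear[of x fold_left]
      linorder_less_linear[of x "1 / 2"] linorder_less_linear[of x 2]
      linorder_less_linear[of x fold_right] by blast
  then show ?thesis
    using True fold_bounds \<open>is_interval {0..T}\<close> \<open>0 \<in> {0..T}\<close>
    by cases (simp_all add: local_trajectory_def times singleton regular_tangencies_Z1
        singular_tangencies_Z1 f1_regions Z1_regions sigma_domain_Z1 slide_set_def)
qed

lemma local_trajectory_Z1_some_arc:
  "0 \<le> T \<Longrightarrow> local_trajectory f1 X1 Y1 p {0..T} \<phi> \<Longrightarrow> some_arc f1 X1 Y1 {0..T} \<phi>"
  by (cases p) (auto simp: local_trajectory_Z1 some_arc_def split: if_splits)

lemma has_vector_derivative_prodD:
  assumes "(\<phi> has_vector_derivative (a, b)) F"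
  shows "((\<lambda>t. fst (\<phi> t)) has_vector_derivative a) F" "((\<lambda>t. snd (\<phi> t)) has_vector_derivative b) F"
  using bounded_linear.has_vector_derivative[OF bounded_linear_fst assms]
    bounded_linear.has_vector_derivative[OF bounded_linear_snd assms] by simp_all

lemma constant_on_interval:
  fixes h :: "real \<Rightarrow> real"
  assumes "\<And>t. t \<in> {a..b} \<Longrightarrow> (h has_real_derivative 0) (at t within {a..b})"
    and "s \<in> {a..b}" "t \<in> {a..b}"
  shows "h s = h t"
  using has_field_derivative_zero_constant[of "{a..b}" h] assms by (metis convex_real_interval(5))

lemma X_arc_Z1_conserved:
  assumes arc: "X_arc f1 X1 {0..T} \<phi>" and "s \<in> {0..T}" "t \<in> {0..T}"
  shows "fst (\<phi> s) - s = fst (\<phi> t) - t"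
    and "snd (\<phi> s) + (fst (\<phi> s))\<^sup>2 - fst (\<phi> s) = snd (\<phi> t) + (fst (\<phi> t))\<^sup>2 - fst (\<phi> t)"
proof -
  have d: "((\<lambda>t. fst (\<phi> t)) has_real_derivative 1) (at r within {0..T})"
    "((\<lambda>t. snd (\<phi> t)) has_real_derivative 1 - 2 * fst (\<phi> r)) (at r within {0..T})"
    if "r \<in> {0..T}" for r
  proof -
    have "(\<phi> has_vector_derivative (1, 1 - 2 * fst (\<phi> r))) (at r within {0..T})"
      using arc that by (auto simp: X_arc_def integral_arc_def X1_def case_prod_unfold)
    from has_vector_derivative_prodD[OF this]
    show "((\<lambda>t. fst (\<phi> t)) has_real_derivative 1) (at r within {0..T})"
      "((\<lambda>t. snd (\<phi> t)) has_real_derivative 1 - 2 * fst (\<phi> r)) (at r within {0..T})"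
      by (simp_all add: has_real_derivative_iff_has_vector_derivative)
  qed
  show "fst (\<phi> s) - s = fst (\<phi> t) - t"
    by (rule constant_on_interval[of 0 T "\<lambda>t. fst (\<phi> t) - t"])
      (auto intro!: derivative_eq_intros d simp: assms[simplified])
  show "snd (\<phi> s) + (fst (\<phi> s))\<^sup>2 - fst (\<phi> s) = snd (\<phi> t) + (fst (\<phi> t))\<^sup>2 - fst (\<phi> t)"
    by (rule constant_on_interval[of 0 T "\<lambda>t. snd (\<phi> t) + (fst (\<phi> t))\<^sup>2 - fst (\<phi> t)"])
      (auto intro!: derivative_eq_intros d simp: assms[simplified])
qed

lemma Y_arc_Z1_conserved:
  assumes arc: "Y_arc f1 Y1 {0..T} \<phi>" and "s \<in> {0..T}" "t \<in> {0..T}"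
  shows "fst (\<phi> s) + s = fst (\<phi> t) + t"
    and "snd (\<phi> s) - quartic (fst (\<phi> s)) = snd (\<phi> t) - quartic (fst (\<phi> t))"
proof -
  have d: "((\<lambda>t. fst (\<phi> t)) has_real_derivative - 1) (at r within {0..T})"
    "((\<lambda>t. snd (\<phi> t)) has_real_derivative Y1_slope (fst (\<phi> r))) (at r within {0..T})"
    if "r \<in> {0..T}" for r
  proof -
    have "(\<phi> has_vector_derivative (- 1, Y1_slope (fst (\<phi> r)))) (at r within {0..T})"
      using arc that by (auto simp: Y_arc_def integral_arc_def Y1_def case_prod_unfold Y1_slope_eq)
    from has_vector_derivative_prodD[OF this]
    show "((\<lambda>t. fst (\<phi> t)) has_real_derivative - 1) (at r within {0..T})"
      "((\<lambda>t. snd (\<phi> t)) has_real_derivative Y1_slope (fst (\<phi> r))) (at r within {0..T})"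
      by (simp_all add: has_real_derivative_iff_has_vector_derivative)
  qed
  show "fst (\<phi> s) + s = fst (\<phi> t) + t"
    by (rule constant_on_interval[of 0 T "\<lambda>t. fst (\<phi> t) + t"])
      (auto intro!: derivative_eq_intros d simp: assms[simplified])
  have q: "((\<lambda>t. quartic (fst (\<phi> t))) has_real_derivative - Y1_slope (fst (\<phi> r)) * - 1) (at r within {0..T})"
    if "r \<in> {0..T}" for r
    using DERIV_chain2[OF quartic_deriv d(1)[OF that]] .
  show "snd (\<phi> s) - quartic (fst (\<phi> s)) = snd (\<phi> t) - quartic (fst (\<phi> t))"
    by (rule constant_on_interval[of 0 T "\<lambda>t. snd (\<phi> t) - quartic (fst (\<phi> t))"])
      (auto intro!: derivative_eq_intros d q simp: assms[simplified])
qed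

lemma sigma_arc_Z1D:
  assumes "sigma_arc f1 X1 Y1 J \<phi>" "t \<in> J"
  shows "snd (\<phi> t) = 0" "fst (\<phi> t) \<in> slide_set"
    "((\<lambda>t. fst (\<phi> t)) has_real_derivative slide (fst (\<phi> t))) (at t within J)"
proof -
  obtain x where x: "x \<in> slide_set" "\<phi> t = (x, 0)"
    using assms by (auto simp: sigma_arc_def integral_arc_def sigma_domain_Z1)
  then show "snd (\<phi> t) = 0" "fst (\<phi> t) \<in> slide_set" by simp_all
  have "(\<phi> has_vector_derivative (slide x, 0)) (at t within J)"
    using assms x sigma_vf_Z1[OF x(1)] by (auto simp: sigma_arc_def integral_arc_def)
  from has_vector_derivative_prodD(1)[OF this] x
  show "((\<lambda>t. fst (\<phi> t)) has_real_derivative slide (fst (\<phi> t))) (at t within J)"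
    by (simp add: has_real_derivative_iff_has_vector_derivative)
qed

section \<open>Steps of \<open>Z\<^sub>1\<close>\<close>

abbreviation Z1_step :: "plane \<Rightarrow> plane \<Rightarrow> real \<Rightarrow> bool" where
  "Z1_step \<equiv> step f1 X1 Y1"

text \<open>
  Orbits of \<open>X\<^sub>1\<close> are concave parabolas, so one that starts and ends in the upper half plane
  stays there.
\<close>

lemma X1_step:
  assumes "x < z" "0 < y \<or> y = 0 \<and> x < 1 / 2" "0 \<le> w" "y + x\<^sup>2 - x = w + z\<^sup>2 - z"
  shows "Z1_step (x, y) (z, w) (z - x)"
proof -
  define \<phi> where "\<phi> t = (x + t, y + x\<^sup>2 - x - (x + t)\<^sup>2 + (x + t))" for t
  have above: "0 \<le> snd (\<phi> t)" if t: "t \<in> {0..z - x}" for t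
  proof -
    have "(z - x) * snd (\<phi> t) = (z - x - t) * y + t * w + (z - x) * (t * (z - x - t))"
      using assms(4) by (simp add: \<phi>_def) algebra
    also have "\<dots> \<ge> 0" using assms t by (intro add_nonneg_nonneg mult_nonneg_nonneg) auto
    finally show ?thesis using assms(1) by (simp add: zero_le_mult_iff)
  qed
  have "(\<phi> has_vector_derivative X1 (\<phi> t)) (at t within {0..z - x})" for t
    unfolding \<phi>_def[abs_def] X1_def has_vector_derivative_def
    by (auto intro!: derivative_eq_intros simp: algebra_simps power2_eq_square)
  then have arc: "X_arc f1 X1 {0..z - x} \<phi>"
    unfolding X_arc_def integral_arc_def using above by (auto simp: upper_region_def f1_def case_prod_unfold)
  have "local_trajectory f1 X1 Y1 (x, y) {0..z - x} \<phi>"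
    using assms fold_bounds arc by (auto simp: local_trajectory_Z1 some_arc_def \<phi>_def)
  moreover have "\<phi> (z - x) = (z, w)" using assms(4) by (simp add: \<phi>_def)
  ultimately show ?thesis unfolding step_def using assms(1) by auto
qed

lemma Y1_step:
  assumes "z < x" "y < 0 \<or> y = 0 \<and> (fold_left < x \<and> x \<le> 2 \<or> fold_right < x)"
    and below: "\<And>s. z \<le> s \<Longrightarrow> s \<le> x \<Longrightarrow> y + quartic s - quartic x \<le> 0"
    and "y - quartic x = w - quartic z"
  shows "Z1_step (x, y) (z, w) (x - z)"
proof -
  define \<phi> where "\<phi> t = (x - t, y + quartic (x - t) - quartic x)" for t
  have "(\<phi> has_vector_derivative Y1 (\<phi> t)) (at t within {0..x - z})" for t
  proof -
    have "((\<lambda>t. x - t) has_real_derivative - 1) (at t within {0..x - z})"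
      by (auto intro!: derivative_eq_intros)
    moreover have "((\<lambda>t. y + quartic (x - t) - quartic x) has_real_derivative Y1_slope (x - t)) (at t within {0..x - z})"
      using DERIV_chain2[OF quartic_deriv calculation] by (auto intro!: derivative_eq_intros)
    ultimately show ?thesis
      unfolding \<phi>_def[abs_def] has_real_derivative_iff_has_vector_derivative
      using has_vector_derivative_Pair by (fastforce simp: Y1_def Y1_slope_eq)
  qed
  then have arc: "Y_arc f1 Y1 {0..x - z} \<phi>"
    unfolding Y_arc_def integral_arc_def using below by (auto simp: lower_region_def f1_def \<phi>_def)
  have "local_trajectory f1 X1 Y1 (x, y) {0..x - z} \<phi>"
    using assms fold_bounds arc by (auto simp: local_trajectory_Z1 some_arc_def \<phi>_def)
  moreover have "\<phi> (x - z) = (z, w)" using assms(4) by (simp add: \<phi>_def)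
  ultimately show ?thesis unfolding step_def using assms(1) by auto
qed

lemma sigma_arc_local_trajectory:
  assumes "sigma_arc f1 X1 Y1 {0..T} \<phi>" "\<phi> 0 = (x, 0)" "x \<in> slide_set" "0 \<le> T"
  shows "local_trajectory f1 X1 Y1 (x, 0) {0..T} \<phi>"
  using assms fold_bounds by (auto simp: local_trajectory_Z1 some_arc_def slide_set_def)

text \<open>
  A slide along which the speed is at most \<open>M\<close> takes at least the time \<open>\<bar>v - u\<bar> / M\<close>; this
  is what keeps infinitely many ever shorter slides from using up only finite time.
\<close>

lemma slide_step:
  assumes "u \<noteq> v" and sub: "closed_segment u v \<subseteq> slide_set"
    and sign: "\<And>x. x \<in> closed_segment u v \<Longrightarrow> 0 < (v - u) * slide x"
    and bound: "\<And>x. x \<in> closed_segment u v \<Longrightarrow> \<bar>slide x\<bar> \<le> M"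
  shows "\<exists>T. \<bar>v - u\<bar> \<le> M * T \<and> Z1_step (u, 0) (v, 0) T"
proof -
  obtain T \<phi> where T: "0 < T" "\<phi> 0 = u" "\<phi> T = v"
    "\<And>t. t \<in> {0..T} \<Longrightarrow> \<phi> t \<in> closed_segment u v"
    "\<And>t. t \<in> {0..T} \<Longrightarrow> (\<phi> has_real_derivative slide (\<phi> t)) (at t within {0..T})"
    using autonomous_arc[OF assms(1) continuous_on_subset[OF continuous_on_slide sub] sign] by blast
  define \<psi> where "\<psi> t = (\<phi> t, 0::real)" for t
  have "(\<psi> has_vector_derivative sigma_vf f1 X1 Y1 (\<psi> t)) (at t within {0..T})"
    and "\<psi> t \<in> sigma_domain f1 X1 Y1" if "t \<in> {0..T}" for t
  proof -
    have s: "\<phi> t \<in> slide_set" using T(4)[OF that] sub by auto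
    then show "\<psi> t \<in> sigma_domain f1 X1 Y1" by (simp add: \<psi>_def sigma_domain_Z1)
    have "(\<psi> has_vector_derivative (slide (\<phi> t), 0)) (at t within {0..T})"
      unfolding \<psi>_def[abs_def]
      using T(5)[OF that] by (intro has_vector_derivative_Pair has_vector_derivative_const)
        (simp add: has_real_derivative_iff_has_vector_derivative)
    then show "(\<psi> has_vector_derivative sigma_vf f1 X1 Y1 (\<psi> t)) (at t within {0..T})"
      using sigma_vf_Z1[OF s] by (simp add: \<psi>_def)
  qed
  then have "sigma_arc f1 X1 Y1 {0..T} \<psi>" by (simp add: sigma_arc_def integral_arc_def)
  then have "local_trajectory f1 X1 Y1 (u, 0) {0..T} \<psi>"
    using T sub by (intro sigma_arc_local_trajectory) (auto simp: \<psi>_def)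
  then have "Z1_step (u, 0) (v, 0) T"
    unfolding step_def using T by (auto simp: \<psi>_def)
  moreover have "norm (\<phi> T - \<phi> 0) \<le> M * norm (T - 0)"
    using T bound by (intro field_differentiable_bound[of "{0..T}" \<phi> "\<lambda>t. slide (\<phi> t)"]) auto
  ultimately show ?thesis using T by (auto simp: abs_minus_commute)
qed

lemma rest_step:
  assumes "x \<in> slide_set" "slide x = 0" "0 < T"
  shows "Z1_step (x, 0) (x, 0) T"
proof -
  have "(x, 0) \<in> sigma_domain f1 X1 Y1" "sigma_vf f1 X1 Y1 (x, 0) = 0"
    using assms by (auto simp: sigma_domain_Z1 sigma_vf_Z1 zero_prod_def)
  then have "sigma_arc f1 X1 Y1 {0..T} (\<lambda>_. (x, 0))"
    by (simp add: sigma_arc_def integral_arc_def)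
  then have "local_trajectory f1 X1 Y1 (x, 0) {0..T} (\<lambda>_. (x, 0))"
    using assms by (intro sigma_arc_local_trajectory) auto
  then show ?thesis unfolding step_def using assms(3) by auto
qed

section \<open>Pseudo-equilibria\<close>

lemma slide_numerator: "Y1_slope x + (1 - 2 * x) = - 4 * x ^ 3 + 15 * x\<^sup>2 + 6 * x - 43"
  unfolding Y1_slope_eq by (simp add: algebra_simps power2_eq_square power3_eq_cube)

lemma slide_eq_0_iff: "x \<in> slide_set \<Longrightarrow> slide x = 0 \<longleftrightarrow> Y1_slope x + (1 - 2 * x) = 0"
  using slide_denominator_nonzero[of x] by (simp add: slide_def)

text \<open>
  The pseudo-equilibria have no convenient closed form, so they are named and located:
  \<open>r0\<close> is an escaping point, \<open>r1\<close> and \<open>r2\<close> are sliding points.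
\<close>

locale Z1_equilibria =
  fixes r0 r1 r2 :: real
  assumes r0: "- 16 / 10 < r0" "r0 < - 15 / 10"
    and r1: "215 / 100 < r1" "r1 < 22 / 10"
    and r2: "3 < r2" "r2 < 32 / 10"
    and numerator: "\<And>x. Y1_slope x + (1 - 2 * x) = - 4 * (x - r0) * (x - r1) * (x - r2)"

lemma Z1_equilibria_exist: "\<exists>r0 r1 r2. Z1_equilibria r0 r1 r2"
proof -
  define S where "S x = - 4 * x ^ 3 + 15 * x\<^sup>2 + 6 * x - 43" for x :: real
  have cont: "continuous_on A S" for A unfolding S_def by (intro continuous_intros)
  have vals: "0 < S (- 16 / 10)" "S (- 15 / 10) < 0" "S (215 / 100) < 0" "0 < S (22 / 10)"
    "0 < S 3" "S (32 / 10) < 0"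
    by (simp_all add: S_def power2_eq_square power3_eq_cube)
  have "\<exists>r. - 16 / 10 \<le> r \<and> r \<le> - 15 / 10 \<and> S r = 0"
    by (intro IVT2' cont) (use vals in linarith)+
  then obtain r0 where r0: "- 16 / 10 \<le> r0" "r0 \<le> - 15 / 10" "S r0 = 0" by blast
  have "\<exists>r. 215 / 100 \<le> r \<and> r \<le> 22 / 10 \<and> S r = 0"
    by (intro IVT' cont) (use vals in linarith)+
  then obtain r1 where r1: "215 / 100 \<le> r1" "r1 \<le> 22 / 10" "S r1 = 0" by blast
  have "\<exists>r. 3 \<le> r \<and> r \<le> 32 / 10 \<and> S r = 0"
    by (intro IVT2' cont) (use vals in linarith)+
  then obtain r2 where r2: "3 \<le> r2" "r2 \<le> 32 / 10" "S r2 = 0" by blast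
  (* Divided differences: a cubic with three distinct zeros is determined by them and its leading coefficient. *)
  define Q where "Q x y = - 4 * (x\<^sup>2 + x * y + y\<^sup>2) + 15 * (x + y) + 6" for x y :: real
  have SQ: "S x - S y = (x - y) * Q x y" for x y
    by (simp add: S_def Q_def algebra_simps power2_eq_square power3_eq_cube)
  have Q_diff: "Q x z - Q y z = (x - y) * (- 4 * (x + y + z) + 15)" for x y z
    by (simp add: Q_def algebra_simps power2_eq_square)
  have "Q r1 r0 = 0" "Q r2 r0 = 0" using SQ[of r1 r0] SQ[of r2 r0] r0 r1 r2 by auto
  then have "- 4 * (r2 + r1 + r0) + 15 = 0" using Q_diff[of r2 r0 r1] r1 r2 by auto
  then have lin: "- 4 * (x + r1 + r0) + 15 = - 4 * (x - r2)" for x by simp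
  have "Q x r0 = (x - r1) * (- 4 * (x - r2))" for x
    using Q_diff[of x r0 r1] \<open>Q r1 r0 = 0\<close> unfolding lin by simp
  then have "S x = (x - r0) * ((x - r1) * (- 4 * (x - r2)))" for x
    using SQ[of x r0] r0 by simp
  moreover have "(x - r0) * ((x - r1) * (- 4 * (x - r2))) = - 4 * (x - r0) * (x - r1) * (x - r2)" for x
    by algebra
  ultimately have "S x = - 4 * (x - r0) * (x - r1) * (x - r2)" for x by metis
  then have num: "Y1_slope x + (1 - 2 * x) = - 4 * (x - r0) * (x - r1) * (x - r2)" for x
    unfolding slide_numerator S_def[symmetric] .
  have "r0 \<noteq> - 16 / 10" "r0 \<noteq> - 15 / 10" "r1 \<noteq> 215 / 100" "r1 \<noteq> 22 / 10" "r2 \<noteq> 3" "r2 \<noteq> 32 / 10"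
    using vals r0(3) r1(3) r2(3) by (metis order_less_irrefl)+
  then have "Z1_equilibria r0 r1 r2"
    using r0(1,2) r1(1,2) r2(1,2) num by unfold_locales (blast intro: order.not_eq_order_implies_strict | metis order.not_eq_order_implies_strict)+
  then show ?thesis by blast
qed

lemma slide_Lipschitz_at_zero:
  assumes r: "r \<in> slide_set" "slide r = 0"
  obtains L where "0 < L" "\<And>x. x \<in> slide_set \<Longrightarrow> \<bar>slide x\<bar> \<le> L * \<bar>x - r\<bar>"
proof -
  define h where "h x = (- 4 * (x\<^sup>2 + x * r + r\<^sup>2) + 15 * (x + r) + 6) / (Y1_slope x - (1 - 2 * x))" for x
  have "continuous_on slide_set h"
    unfolding h_def Y1_slope_def[abs_def]
    by (intro continuous_intros) (use slide_denominator_nonzero in \<open>auto simp: Y1_slope_def\<close>)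
  moreover have "compact slide_set" by (auto simp: slide_set_def)
  ultimately have "bounded (h ` slide_set)"
    by (intro compact_imp_bounded compact_continuous_image)
  then obtain L where L: "0 < L" "\<And>x. x \<in> slide_set \<Longrightarrow> \<bar>h x\<bar> \<le> L"
    unfolding bounded_pos by auto
  have "slide x = h x * (x - r)" for x
  proof -
    have "Y1_slope x + (1 - 2 * x) - (Y1_slope r + (1 - 2 * r)) =
        (- 4 * (x\<^sup>2 + x * r + r\<^sup>2) + 15 * (x + r) + 6) * (x - r)"
      unfolding slide_numerator by (simp add: algebra_simps power2_eq_square power3_eq_cube)
    then show ?thesis using r slide_eq_0_iff[of r] by (simp add: h_def slide_def)
  qed
  then show ?thesis using L by (intro that[of L]) (auto simp: abs_mult intro: mult_right_mono)
qed

text \<open>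
  Zeno's itinerary towards an equilibrium: each step halves the distance, but the speed is
  at most proportional to the distance, so that every step takes a time bounded below.
\<close>

lemma half_slide_step:
  assumes r: "r \<in> slide_set" "slide r = 0" "0 < L"
    and L: "\<And>x. x \<in> slide_set \<Longrightarrow> \<bar>slide x\<bar> \<le> L * \<bar>x - r\<bar>"
    and "x \<noteq> r" and uv: "u = x \<and> v = (x + r) / 2 \<or> v = x \<and> u = (x + r) / 2"
    and sub: "closed_segment u v \<subseteq> slide_set"
    and sign: "\<And>s. s \<in> closed_segment u v \<Longrightarrow> 0 < (v - u) * slide s"
  shows "\<exists>T\<ge>1 / (2 * L). Z1_step (u, 0) (v, 0) T"
proof -
  have "u \<noteq> v" using uv \<open>x \<noteq> r\<close> by auto
  have "\<bar>s - r\<bar> \<le> \<bar>x - r\<bar>" if "s \<in> closed_segment u v" for s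
    using that uv by (auto simp: closed_segment_eq_real_ivl split: if_splits)
  then have "\<bar>slide s\<bar> \<le> L * \<bar>x - r\<bar>" if "s \<in> closed_segment u v" for s
    using L[of s] sub that \<open>0 < L\<close> by (meson mult_left_mono order.trans less_imp_le subsetD)
  from slide_step[OF \<open>u \<noteq> v\<close> sub sign this] obtain T
    where T: "\<bar>v - u\<bar> \<le> L * \<bar>x - r\<bar> * T" "Z1_step (u, 0) (v, 0) T" by blast
  have "\<bar>v - u\<bar> = \<bar>x - r\<bar> / 2" using uv by (auto simp: abs_if field_simps)
  then have "\<bar>x - r\<bar> * 1 \<le> \<bar>x - r\<bar> * (2 * L * T)" using T(1) by (simp add: algebra_simps)
  then have "1 \<le> 2 * L * T" using \<open>x \<noteq> r\<close> by (subst (asm) mult_le_cancel_left_pos) auto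
  then have "1 / (2 * L) \<le> T" using \<open>0 < L\<close> by (simp add: field_simps)
  then show ?thesis using T(2) by blast
qed

lemma endless_at_equilibrium:
  assumes "r \<in> slide_set" "slide r = 0"
  shows "endless Z1_step (r, 0)" "endless (step_back f1 X1 Y1) (r, 0)"
  using rest_step[OF assms, of 1]
  by (auto intro!: endless_if_steps_last[of 1 "(r, 0)" "{(r, 0)}"])

lemma endless_near_equilibrium:
  assumes r: "r \<in> slide_set" "slide r = 0" "r \<in> I" and I: "I \<subseteq> slide_set" "convex I" and "x \<in> I"
  shows "(\<And>s. s \<in> I \<Longrightarrow> s \<noteq> r \<Longrightarrow> (s - r) * slide s < 0) \<Longrightarrow> endless Z1_step (x, 0)"
    and "(\<And>s. s \<in> I \<Longrightarrow> s \<noteq> r \<Longrightarrow> 0 < (s - r) * slide s) \<Longrightarrow> endless (step_back f1 X1 Y1) (x, 0)"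
proof -
  obtain L where L: "0 < L" "\<And>x. x \<in> slide_set \<Longrightarrow> \<bar>slide x\<bar> \<le> L * \<bar>x - r\<bar>"
    using slide_Lipschitz_at_zero r by blast
  have rest: "Z1_step (r, 0) (r, 0) (1 / (2 * L))" using r L by (intro rest_step) auto
  have mid: "(y + r) / 2 \<in> I" "closed_segment y ((y + r) / 2) \<subseteq> I" if "y \<in> I" for y
  proof -
    have "(1 / 2) *\<^sub>R y + (1 / 2) *\<^sub>R r \<in> I" using I r that by (intro convexD) auto
    then show "(y + r) / 2 \<in> I" by (simp add: add_divide_distrib)
    then show "closed_segment y ((y + r) / 2) \<subseteq> I" using I that by (intro closed_segment_subset)
  qed
  have side: "0 < (s - r) * (y - r)" if "y \<noteq> r" "s \<in> closed_segment y ((y + r) / 2)" for s y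
    using that by (auto simp: closed_segment_eq_real_ivl zero_less_mult_iff split: if_splits)
  {
    assume sign: "\<And>s. s \<in> I \<Longrightarrow> s \<noteq> r \<Longrightarrow> (s - r) * slide s < 0"
    have move: "\<exists>T\<ge>1 / (2 * L). Z1_step (y, 0) ((y + r) / 2, 0) T" if y: "y \<in> I" "y \<noteq> r" for y
    proof (rule half_slide_step[OF r(1,2) L y(2)])
      show "closed_segment y ((y + r) / 2) \<subseteq> slide_set" using mid(2)[OF y(1)] I by blast
      show "0 < ((y + r) / 2 - y) * slide s" if s: "s \<in> closed_segment y ((y + r) / 2)" for s
      proof -
        have "s \<in> I" "s \<noteq> r" using side[OF y(2) s] mid(2)[OF y(1)] s by auto
        then have "(y - r) * slide s < 0"
          using side[OF y(2) s] sign[of s] by (auto simp: zero_less_mult_iff mult_less_0_iff)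
        then show ?thesis by (simp add: field_simps)
      qed
    qed auto
    have "\<exists>q\<in>(\<lambda>x. (x, 0)) ` I. \<exists>T\<ge>1 / (2 * L). Z1_step p q T" if p: "p \<in> (\<lambda>x. (x, 0)) ` I" for p
    proof -
      obtain y where y: "y \<in> I" "p = (y, 0)" using p by auto
      show ?thesis
      proof (cases "y = r")
        case True
        then show ?thesis using y rest by (intro bexI[of _ p] exI[of _ "1 / (2 * L)"]) auto
      next
        case False
        then obtain T where "1 / (2 * L) \<le> T" "Z1_step (y, 0) ((y + r) / 2, 0) T" using move y by blast
        then show ?thesis using y mid(1) by (intro bexI[of _ "((y + r) / 2, 0)"] exI[of _ T]) auto
      qed
    qed
    then show "endless Z1_step (x, 0)"
      using L \<open>x \<in> I\<close> by (intro endless_if_steps_last[of "1 / (2 * L)" _ "(\<lambda>x. (x, 0)) ` I"]) auto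
  }
  {
    assume sign: "\<And>s. s \<in> I \<Longrightarrow> s \<noteq> r \<Longrightarrow> 0 < (s - r) * slide s"
    have move: "\<exists>T\<ge>1 / (2 * L). Z1_step ((y + r) / 2, 0) (y, 0) T" if y: "y \<in> I" "y \<noteq> r" for y
    proof (rule half_slide_step[OF r(1,2) L y(2)])
      show "closed_segment ((y + r) / 2) y \<subseteq> slide_set"
        using mid(2)[OF y(1)] I by (simp add: closed_segment_commute)
      show "0 < (y - (y + r) / 2) * slide s" if "s \<in> closed_segment ((y + r) / 2) y" for s
      proof -
        have s: "s \<in> closed_segment y ((y + r) / 2)" using that by (simp add: closed_segment_commute)
        have "s \<in> I" "s \<noteq> r" using side[OF y(2) s] mid(2)[OF y(1)] s by auto
        then have "0 < (y - r) * slide s"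
          using side[OF y(2) s] sign[of s] by (auto simp: zero_less_mult_iff)
        then show ?thesis by (simp add: field_simps)
      qed
    qed auto
    have "\<exists>q\<in>(\<lambda>x. (x, 0)) ` I. \<exists>T\<ge>1 / (2 * L). Z1_step q p T" if p: "p \<in> (\<lambda>x. (x, 0)) ` I" for p
    proof -
      obtain y where y: "y \<in> I" "p = (y, 0)" using p by auto
      show ?thesis
      proof (cases "y = r")
        case True
        then show ?thesis using y rest by (intro bexI[of _ p] exI[of _ "1 / (2 * L)"]) auto
      next
        case False
        then obtain T where "1 / (2 * L) \<le> T" "Z1_step ((y + r) / 2, 0) (y, 0) T" using move y by blast
        then show ?thesis using y mid(1) by (intro bexI[of _ "((y + r) / 2, 0)"] exI[of _ T]) auto
      qed
    qed
    then show "endless (step_back f1 X1 Y1) (x, 0)"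
      using L \<open>x \<in> I\<close> by (intro endless_if_steps_last[of "1 / (2 * L)" _ "(\<lambda>x. (x, 0)) ` I"]) auto
  }
qed

context Z1_equilibria
begin

lemma equilibria_in_slide_set: "r0 \<in> slide_set" "r1 \<in> slide_set" "r2 \<in> slide_set"
  using r0 r1 r2 fold_bounds by (auto simp: slide_set_def)

lemma slide_equilibria [simp]: "slide r0 = 0" "slide r1 = 0" "slide r2 = 0"
  by (simp_all add: slide_def numerator)

lemma slide_sign:
  "fold_left \<le> x \<Longrightarrow> x < r0 \<Longrightarrow> slide x < 0"
  "r0 < x \<Longrightarrow> x \<le> 1 / 2 \<Longrightarrow> 0 < slide x"
  "2 \<le> x \<Longrightarrow> x < r1 \<Longrightarrow> slide x < 0"
  "r1 < x \<Longrightarrow> x < r2 \<Longrightarrow> 0 < slide x"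
  "r2 < x \<Longrightarrow> x \<le> fold_right \<Longrightarrow> slide x < 0"
proof -
  have eq: "slide x = - 4 * (x - r0) * (x - r1) * (x - r2) / (Y1_slope x - (1 - 2 * x))"
    by (simp add: slide_def numerator)
  note bounds = r0 r1 r2 fold_bounds
  show "slide x < 0" if "fold_left \<le> x" "x < r0"
    using that bounds slide_denominator(1)[of x] unfolding eq
    by (auto simp: divide_less_0_iff mult_less_0_iff zero_less_mult_iff)
  show "0 < slide x" if "r0 < x" "x \<le> 1 / 2"
    using that bounds slide_denominator(1)[of x] unfolding eq
    by (auto simp: zero_less_divide_iff mult_less_0_iff zero_less_mult_iff)
  show "slide x < 0" if "2 \<le> x" "x < r1"
    using that bounds slide_denominator(2)[of x] unfolding eq
    by (auto simp: divide_less_0_iff mult_less_0_iff zero_less_mult_iff)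
  show "0 < slide x" if "r1 < x" "x < r2"
    using that bounds slide_denominator(2)[of x] unfolding eq
    by (auto simp: zero_less_divide_iff mult_less_0_iff zero_less_mult_iff)
  show "slide x < 0" if "r2 < x" "x \<le> fold_right"
    using that bounds slide_denominator(2)[of x] unfolding eq
    by (auto simp: divide_less_0_iff mult_less_0_iff zero_less_mult_iff)
qed

end

section \<open>Steps inside \<open>\<Lambda>\<^sub>1\<close>\<close>

text \<open>
  Off the switching line \<open>\<Lambda>\<^sub>1\<close> is a sublevel set of the first integral of \<open>X\<^sub>1\<close>
  above and a superlevel set of that of \<open>Y\<^sub>1\<close> below; the bounds on the abscissa follow.
\<close>

lemma Lambda1_iff:
  "(x, y) \<in> Lambda1 \<longleftrightarrow> 0 \<le> y \<and> y + x\<^sup>2 - x \<le> 12 \<or> y \<le> 0 \<and> quartic x \<le> y"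
proof -
  have parabola: "- ((- 4 + x) * (3 + x)) = 12 + x - x\<^sup>2"
    by (simp add: algebra_simps power2_eq_square)
  have range: "- 3 \<le> x \<and> x \<le> 4 \<longleftrightarrow> 0 \<le> - ((- 4 + x) * (3 + x))"
    by (auto simp: mult_le_0_iff)
  have pos: "0 < quartic x" if "x < - 3 \<or> 4 < x"
    using that by (auto simp: quartic_def zero_less_mult_iff mult_less_0_iff)
  show ?thesis
    unfolding Lambda1_def quartic_def[symmetric] mem_Collect_eq case_prod_conv
    using quartic_nonpos[of x] pos range[unfolded parabola] unfolding parabola by (smt (verit))
qed

lemma Lambda1_bounds: "(x, y) \<in> Lambda1 \<Longrightarrow> - 3 \<le> x \<and> x \<le> 4"
  by (simp add: Lambda1_def)

lemma line_in_Lambda1: "- 3 \<le> x \<Longrightarrow> x \<le> 4 \<Longrightarrow> (x, 0) \<in> Lambda1"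
  by (auto simp: Lambda1_iff quartic_nonpos)

lemma continuous_on_quartic: "continuous_on A quartic"
  unfolding quartic_def[abs_def] by (intro continuous_intros)

lemma slide_bounded: "\<exists>M. \<forall>x\<in>slide_set. \<bar>slide x\<bar> \<le> M"
proof -
  have "compact slide_set" by (auto simp: slide_set_def)
  then have "bounded (slide ` slide_set)"
    by (intro compact_imp_bounded compact_continuous_image continuous_on_slide)
  then show ?thesis unfolding bounded_real by auto
qed

lemma quartic_first_level:
  assumes "u < w" "quartic u < c" "c \<le> quartic w"
  obtains z where "u < z" "z \<le> w" "quartic z = c" "\<And>s. u \<le> s \<Longrightarrow> s < z \<Longrightarrow> quartic s < c"
proof -
  have "continuous_on {u..w} (\<lambda>s. quartic s - c)" "quartic u - c < 0" "0 \<le> quartic w - c"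
    using assms by (auto intro!: continuous_intros continuous_on_quartic)
  from first_zero[OF assms(1) this] obtain z
    where "u < z" "z \<le> w" "quartic z - c = 0" "\<And>s. u \<le> s \<Longrightarrow> s < z \<Longrightarrow> quartic s - c < 0"
    by blast
  then show ?thesis by (intro that[of z]) auto
qed

lemma quartic_last_level:
  assumes "w < u" "quartic u < c" "c \<le> quartic w"
  obtains z where "w \<le> z" "z < u" "quartic z = c" "\<And>s. z < s \<Longrightarrow> s \<le> u \<Longrightarrow> quartic s < c"
proof -
  have "continuous_on {w..u} (\<lambda>s. quartic s - c)" "quartic u - c < 0" "0 \<le> quartic w - c"
    using assms by (auto intro!: continuous_intros continuous_on_quartic)
  from last_zero[OF assms(1) this] obtain z
    where "w \<le> z" "z < u" "quartic z - c = 0" "\<And>s. z < s \<Longrightarrow> s \<le> u \<Longrightarrow> quartic s - c < 0"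
    by blast
  then show ?thesis by (intro that[of z]) auto
qed

lemma reflect_step: "x < 1 / 2 \<Longrightarrow> Z1_step (x, 0) (1 - x, 0) (1 - 2 * x)"
  using X1_step[of x "1 - x" 0 0] by (simp add: power2_eq_square algebra_simps)

lemma step_to_line:
  assumes "(x, y) \<in> Lambda1" "y \<noteq> 0"
  shows "\<exists>z T. - 3 \<le> z \<and> z \<le> 4 \<and> Z1_step (x, y) (z, 0) T"
proof (cases "0 < y")
  case True
  have x: "- 3 \<le> x" "x \<le> 4" using Lambda1_bounds assms by auto
  have "y + x\<^sup>2 - x \<le> 12" using assms True by (auto simp: Lambda1_iff)
  then have "\<exists>z. x \<le> z \<and> z \<le> 4 \<and> y + x\<^sup>2 - x - z\<^sup>2 + z = 0"
    using x True by (intro IVT2') (auto intro!: continuous_intros)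
  then obtain z where z: "x \<le> z" "z \<le> 4" "y + x\<^sup>2 - x - z\<^sup>2 + z = 0" by blast
  have "x < z" using z True by (cases "x = z") auto
  have "Z1_step (x, y) (z, 0) (z - x)"
    using \<open>x < z\<close> True z(3) by (intro X1_step) auto
  then show ?thesis using x z by (intro exI[of _ z] exI[of _ "z - x"]) auto
next
  case False
  then have "y < 0" "quartic x \<le> y" "- 3 \<le> x" "x \<le> 4"
    using assms Lambda1_bounds[OF assms(1)] by (auto simp: Lambda1_iff)
  moreover from this have "- 3 < x" by (cases "x = - 3") auto
  ultimately obtain z where z: "- 3 \<le> z" "z < x" "quartic z = quartic x - y"
      "\<And>s. z < s \<Longrightarrow> s \<le> x \<Longrightarrow> quartic s < quartic x - y"
    using quartic_last_level[of "- 3" x "quartic x - y"] by auto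
  have "Z1_step (x, y) (z, 0) (x - z)"
  proof (rule Y1_step[OF z(2)])
    show "y + quartic s - quartic x \<le> 0" if "z \<le> s" "s \<le> x" for s
      using z(3) z(4)[of s] that by (cases "s = z") auto
  qed (use z \<open>y < 0\<close> in auto)
  then show ?thesis using z \<open>x \<le> 4\<close> by (intro exI[of _ z] exI[of _ "x - z"]) auto
qed

lemma step_from_line:
  assumes "(x, y) \<in> Lambda1" "y \<noteq> 0"
  shows "\<exists>z T. - 3 \<le> z \<and> z \<le> 4 \<and> Z1_step (z, 0) (x, y) T"
proof (cases "0 < y")
  case True
  have x: "- 3 \<le> x" "x \<le> 4" using Lambda1_bounds assms by auto
  have "y + x\<^sup>2 - x \<le> 12" using assms True by (auto simp: Lambda1_iff)
  then have "\<exists>z. - 3 \<le> z \<and> z \<le> x \<and> y + x\<^sup>2 - x - z\<^sup>2 + z = 0"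
    using x True by (intro IVT') (auto intro!: continuous_intros)
  then obtain z where z: "- 3 \<le> z" "z \<le> x" "y + x\<^sup>2 - x - z\<^sup>2 + z = 0" by blast
  have "z < x" using z True by (cases "x = z") auto
  have "y = (x - z) * (1 - x - z)" using z(3) by (simp add: algebra_simps power2_eq_square)
  then have "0 < 1 - x - z" using True \<open>z < x\<close> by (simp add: zero_less_mult_iff)
  then have "z < 1 / 2" using \<open>z < x\<close> by simp
  then have "Z1_step (z, 0) (x, y) (x - z)"
    using \<open>z < x\<close> True z(3) by (intro X1_step) auto
  then show ?thesis using x z by (intro exI[of _ z] exI[of _ "x - z"]) auto
next
  case False
  then have y: "y < 0" "quartic x \<le> y" "- 3 \<le> x" "x \<le> 4"
    using assms Lambda1_bounds[OF assms(1)] by (auto simp: Lambda1_iff)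
  moreover from this have "x < 4" by (cases "x = 4") auto
  ultimately obtain z where z: "x < z" "z \<le> 4" "quartic z = quartic x - y"
      "\<And>s. x \<le> s \<Longrightarrow> s < z \<Longrightarrow> quartic s < quartic x - y"
    using quartic_first_level[of x 4 "quartic x - y"] by auto
  (* The first zero lies on an increasing branch of the quartic, where Y1 leaves the line downwards. *)
  have "\<not> z \<le> fold_left"
    using quartic_less_decreasing[of x z] z y by auto
  moreover have "\<not> (2 < z \<and> z \<le> fold_right)"
  proof
    assume "2 < z \<and> z \<le> fold_right"
    then have "quartic z < quartic (max x 2)" "quartic (max x 2) < quartic x - y"
      using z(1) by (auto intro: quartic_less_decreasing z(4))
    then show False using z(3) by linarith
  qed
  ultimately have start: "fold_left < z \<and> z \<le> 2 \<or> fold_right < z" by linarith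
  have "Z1_step (z, 0) (x, y) (z - x)"
  proof (rule Y1_step[OF z(1)])
    show "0 + quartic s - quartic z \<le> 0" if "x \<le> s" "s \<le> z" for s
      using z(3) z(4)[of s] that by (cases "s = z") auto
  qed (use z start in auto)
  then show ?thesis using z y by (intro exI[of _ z] exI[of _ "z - x"]) auto
qed

text \<open>
  A point to the left of \<open>fold_left\<close> is the end of an arc of \<open>Y\<^sub>1\<close> through a well of the quartic,
  which starts on the opposite wall at the same level.
\<close>

lemma step_to_sewing_up:
  assumes "- 3 \<le> x" "x < fold_left"
  shows "\<exists>z T. fold_left < z \<and> z \<le> 2 \<and> Z1_step (z, 0) (x, 0) T"
proof -
  have "quartic fold_left < quartic x" "quartic x \<le> 0"
    using quartic_less_decreasing[of x fold_left] quartic_nonpos[of x] assms fold_bounds by auto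
  then obtain z where z: "fold_left < z" "z \<le> 2" "quartic z = quartic x"
      "\<And>s. fold_left \<le> s \<Longrightarrow> s < z \<Longrightarrow> quartic s < quartic x"
    using quartic_first_level[of fold_left 2 "quartic x"] fold_bounds by auto
  have "Z1_step (z, 0) (x, 0) (z - x)"
  proof (rule Y1_step)
    show "0 + quartic s - quartic z \<le> 0" if "x \<le> s" "s \<le> z" for s
      using z(3) z(4)[of s] quartic_less_decreasing[of x s] that
      by (cases "s = x \<or> s = z"; cases "s \<le> fold_left") auto
  qed (use z assms in auto)
  then show ?thesis using z by blast
qed

section \<open>Endless itineraries from every point of \<open>\<Lambda>\<^sub>1\<close>\<close>

context Z1_equilibria
begin

text \<open>
  To the right of \<open>r1\<close> a sliding point creeps towards \<open>r2\<close>, at \<open>r1\<close> it rests, and to the left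
  it slides to the visible tangency \<open>2\<close> and joins the boundary of \<open>\<Lambda>\<^sub>1\<close>, a closed orbit. From
  every other point of the line arcs of \<open>X\<^sub>1\<close> and \<open>Y\<^sub>1\<close> lead to \<open>{2..4}\<close>, and from there to one
  of these three cases.
\<close>

lemma endless_forward_line:
  assumes "- 3 \<le> x" "x \<le> 4"
  shows "endless Z1_step (x, 0)"
proof -
  have attracted: "endless Z1_step (x, 0)" if "r1 < x" "x \<le> fold_right" for x
  proof (rule endless_near_equilibrium(1))
    show "r2 \<in> {r1<..fold_right}" "{r1<..fold_right} \<subseteq> slide_set"
      using r1 r2 fold_bounds by (auto simp: slide_set_def)
    show "(s - r2) * slide s < 0" if "s \<in> {r1<..fold_right}" "s \<noteq> r2" for s
      using that slide_sign(4,5)[of s] by (cases "s < r2") (auto simp: mult_less_0_iff)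
  qed (use that equilibria_in_slide_set in auto)
  (* The boundary of Lambda1: a short and a long arc of Y1 and, between them, a parabola. *)
  have boundary: "endless Z1_step (2, 0)"
  proof (rule endless_if_steps_last[of 1 _ "{(2, 0), (- 3, 0), (4, 0)}"])
    have "Z1_step (2, 0) (- 3, 0) 5" "Z1_step (- 3, 0) (4, 0) 7" "Z1_step (4, 0) (2, 0) 2"
      using Y1_step[of "- 3" 2 0 0] reflect_step[of "- 3"] Y1_step[of 2 4 0 0] fold_bounds
      by (auto simp: quartic_nonpos)
    note loop = this
    fix p :: plane assume "p \<in> {(2, 0), (- 3, 0), (4, 0)}"
    then consider "p = (2, 0)" | "p = (- 3, 0)" | "p = (4, 0)" by blast
    then show "\<exists>q\<in>{(2, 0), (- 3, 0), (4, 0)}. \<exists>t\<ge>1. Z1_step p q t"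
    proof cases
      case 1
      then show ?thesis using loop(1) by (intro bexI[of _ "(- 3, 0)"] exI[of _ 5]) auto
    next
      case 2
      then show ?thesis using loop(2) by (intro bexI[of _ "(4, 0)"] exI[of _ 7]) auto
    next
      case 3
      then show ?thesis using loop(3) by (intro bexI[of _ "(2, 0)"] exI[of _ 2]) auto
    qed
  qed auto
  have falling: "endless Z1_step (x, 0)" if "2 < x" "x < r1" for x
  proof -
    have seg: "closed_segment x 2 = {2..x}" using that by (simp add: closed_segment_eq_real_ivl)
    have sub: "{2..x} \<subseteq> slide_set" using that r1 fold_bounds by (auto simp: slide_set_def)
    obtain M where "\<forall>s\<in>slide_set. \<bar>slide s\<bar> \<le> M" using slide_bounded ..
    then have "\<exists>T. \<bar>2 - x\<bar> \<le> M * T \<and> Z1_step (x, 0) (2, 0) T"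
      using that slide_sign(3) sub by (intro slide_step) (auto simp: seg zero_less_mult_iff)
    then show ?thesis using endless_prepend[of Z1_step, OF _ boundary] by blast
  qed
  have sliding: "endless Z1_step (x, 0)" if "2 \<le> x" "x \<le> fold_right" for x
  proof -
    consider "x = 2" | "2 < x" "x < r1" | "x = r1" | "r1 < x" using \<open>2 \<le> x\<close> by linarith
    then show ?thesis
      using attracted[of x] boundary falling[of x] \<open>x \<le> fold_right\<close>
        endless_at_equilibrium(1)[of r1] equilibria_in_slide_set by cases auto
  qed
  have right: "endless Z1_step (x, 0)" if "2 \<le> x" "x \<le> 4" for x
  proof (cases "x \<le> fold_right")
    case False
    have "quartic fold_right < quartic x" "quartic x \<le> 0"
      using quartic_less_increasing[of fold_right x] quartic_nonpos[of x] that False by auto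
    then obtain z where z: "2 \<le> z" "z < fold_right" "quartic z = quartic x"
        "\<And>s. z < s \<Longrightarrow> s \<le> fold_right \<Longrightarrow> quartic s < quartic x"
      using quartic_last_level[of 2 fold_right "quartic x"] fold_bounds by auto
    have "Z1_step (x, 0) (z, 0) (x - z)"
    proof (rule Y1_step)
      show "0 + quartic s - quartic x \<le> 0" if "z \<le> s" "s \<le> x" for s
        using z(3) z(4)[of s] quartic_less_increasing[of s x] that
        by (cases "s = z \<or> s = x"; cases "s \<le> fold_right") auto
    qed (use z False in auto)
    from endless_prepend[of Z1_step, OF this sliding] show ?thesis using z by simp
  qed (use sliding that in auto)
  have left: "endless Z1_step (x, 0)" if "- 3 \<le> x" "x \<le> fold_left" for x
    using that fold_bounds by (intro endless_prepend[of Z1_step, OF reflect_step right]) auto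
  have middle: "endless Z1_step (x, 0)" if "1 / 2 \<le> x" "x < 2" for x
  proof -
    have "quartic fold_left < quartic x" "quartic x \<le> 0"
      using quartic_less_increasing[of fold_left x] quartic_nonpos[of x] that fold_bounds by auto
    then obtain z where z: "- 3 \<le> z" "z < fold_left" "quartic z = quartic x"
        "\<And>s. z < s \<Longrightarrow> s \<le> fold_left \<Longrightarrow> quartic s < quartic x"
      using quartic_last_level[of "- 3" fold_left "quartic x"] fold_bounds by auto
    have "Z1_step (x, 0) (z, 0) (x - z)"
    proof (rule Y1_step)
      show "0 + quartic s - quartic x \<le> 0" if "z \<le> s" "s \<le> x" for s
        using z(3) z(4)[of s] quartic_less_increasing[of s x] that \<open>x < 2\<close>
        by (cases "s = z \<or> s = x"; cases "s \<le> fold_left") auto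
    qed (use z that fold_bounds in auto)
    from endless_prepend[of Z1_step, OF this left] show ?thesis using z by simp
  qed
  have escaping: "endless Z1_step (x, 0)" if "fold_left < x" "x < 1 / 2" for x
  proof -
    have "endless Z1_step (1 - x, 0)"
      using that right[of "1 - x"] middle[of "1 - x"] fold_bounds by (cases "1 - x < 2") auto
    from endless_prepend[of Z1_step, OF reflect_step this] show ?thesis using that by simp
  qed
  show ?thesis
    using assms right[of x] left[of x] middle[of x] escaping[of x] by linarith
qed

text \<open>
  Backwards there is a single destination: an escaping arc followed backwards creeps towards
  \<open>r0\<close>, and from every other point of the line arcs of \<open>X\<^sub>1\<close> and \<open>Y\<^sub>1\<close> followed backwards lead
  to the escaping segment.
\<close>

lemma endless_backward_line:
  assumes "- 3 \<le> x" "x \<le> 4"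
  shows "endless (step_back f1 X1 Y1) (x, 0)"
proof -
  have escaping: "endless (step_back f1 X1 Y1) (x, 0)" if "fold_left \<le> x" "x \<le> 1 / 2" for x
  proof (rule endless_near_equilibrium(2))
    show "r0 \<in> {fold_left..1 / 2}" "{fold_left..1 / 2} \<subseteq> slide_set"
      using r0 fold_bounds by (auto simp: slide_set_def)
    show "0 < (s - r0) * slide s" if "s \<in> {fold_left..1 / 2}" "s \<noteq> r0" for s
      using that slide_sign(1,2)[of s] by (cases "s < r0") (auto simp: zero_less_mult_iff)
  qed (use that equilibria_in_slide_set in auto)
  have reflected: "endless (step_back f1 X1 Y1) (x, 0)"
    if "1 / 2 < x" "endless (step_back f1 X1 Y1) (1 - x, 0)" for x
  proof -
    have "Z1_step (1 - x, 0) (x, 0) (1 - 2 * (1 - x))"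
      using reflect_step[of "1 - x"] that(1) by simp
    from endless_prepend[of "step_back f1 X1 Y1", OF this that(2)] show ?thesis .
  qed
  have middle: "endless (step_back f1 X1 Y1) (x, 0)" if "fold_left \<le> x" "x \<le> 2" for x
    using escaping[of x] reflected[of x] escaping[of "1 - x"] that fold_bounds by linarith
  have left: "endless (step_back f1 X1 Y1) (x, 0)" if "- 3 \<le> x" "x < fold_left" for x
  proof -
    from step_to_sewing_up[OF that] obtain z T
      where z: "fold_left < z" "z \<le> 2" "Z1_step (z, 0) (x, 0) T" by blast
    then show ?thesis
      using endless_prepend[of "step_back f1 X1 Y1", OF z(3) middle] by simp
  qed
  show ?thesis
    using assms middle[of x] left[of x] reflected[of x] middle[of "1 - x"] left[of "1 - x"] by linarith
qed

lemma endless_Lambda1: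
  assumes "p \<in> Lambda1"
  shows "endless Z1_step p" "endless (step_back f1 X1 Y1) p"
proof -
  obtain x y where p: "p = (x, y)" by (cases p)
  note xy = assms[unfolded p]
  have x: "- 3 \<le> x" "x \<le> 4" using Lambda1_bounds[OF xy] by auto
  show "endless Z1_step p"
  proof (cases "y = 0")
    case False
    then obtain z T where z: "- 3 \<le> z" "z \<le> 4" "Z1_step (x, y) (z, 0) T"
      using step_to_line[OF xy] by blast
    from endless_prepend[of Z1_step, OF z(3) endless_forward_line[OF z(1,2)]] show ?thesis by (simp add: p)
  qed (use endless_forward_line[OF x] p in simp)
  show "endless (step_back f1 X1 Y1) p"
  proof (cases "y = 0")
    case False
    then obtain z T where z: "- 3 \<le> z" "z \<le> 4" "Z1_step (z, 0) (x, y) T"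
      using step_from_line[OF xy] by blast
    from endless_prepend[of "step_back f1 X1 Y1", OF z(3) endless_backward_line[OF z(1,2)]]
    show ?thesis by (simp add: p)
  qed (use endless_backward_line[OF x] p in simp)
qed

end

section \<open>Invariance of \<open>\<Lambda>\<^sub>1\<close>\<close>

lemma Lambda1_upper: "0 \<le> y \<Longrightarrow> (x, y) \<in> Lambda1 \<longleftrightarrow> y + x\<^sup>2 - x \<le> 12"
proof -
  assume y: "0 \<le> y"
  have "x\<^sup>2 - x \<le> 12" if "(x, y) \<in> Lambda1"
  proof -
    have "(x - 4) * (x + 3) \<le> 0"
      using Lambda1_bounds[OF that] by (auto simp: mult_le_0_iff)
    then show ?thesis by (simp add: algebra_simps power2_eq_square)
  qed
  then show ?thesis using y Lambda1_iff[of x y] by (cases "y = 0") auto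
qed

lemma Lambda1_lower: "y \<le> 0 \<Longrightarrow> (x, y) \<in> Lambda1 \<longleftrightarrow> quartic x \<le> y"
proof (cases "y = 0")
  case True
  have "quartic x \<le> 0" if "(x, 0) \<in> Lambda1"
    using quartic_nonpos Lambda1_bounds[OF that] by blast
  then show ?thesis using True Lambda1_iff[of x 0] by blast
qed (use Lambda1_iff[of x y] in auto)

text \<open>
  The curved boundary pieces of \<open>\<Lambda>\<^sub>1\<close> are level curves of the two first integrals, and both
  the sliding and the escaping segment lie inside. So no arc crosses the boundary, in either time
  direction.
\<close>

lemma some_arc_Lambda1:
  assumes arc: "some_arc f1 X1 Y1 {0..T} \<phi>" and s: "s \<in> {0..T}" "\<phi> s \<in> Lambda1" and t: "t \<in> {0..T}"
  shows "\<phi> t \<in> Lambda1"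
  using arc unfolding some_arc_def
proof (elim disjE)
  assume X: "X_arc f1 X1 {0..T} \<phi>"
  then have "0 \<le> snd (\<phi> r)" if "r \<in> {0..T}" for r
    using that by (auto simp: X_arc_def integral_arc_def upper_region_def f1_def case_prod_unfold)
  then show ?thesis
    using X_arc_Z1_conserved(2)[OF X s(1) t] s t
      Lambda1_upper[of "snd (\<phi> s)" "fst (\<phi> s)"] Lambda1_upper[of "snd (\<phi> t)" "fst (\<phi> t)"] by auto
next
  assume Y: "Y_arc f1 Y1 {0..T} \<phi>"
  then have "snd (\<phi> r) \<le> 0" if "r \<in> {0..T}" for r
    using that by (auto simp: Y_arc_def integral_arc_def lower_region_def f1_def case_prod_unfold)
  then show ?thesis
    using Y_arc_Z1_conserved(2)[OF Y s(1) t] s t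
      Lambda1_lower[of "snd (\<phi> s)" "fst (\<phi> s)"] Lambda1_lower[of "snd (\<phi> t)" "fst (\<phi> t)"] by auto
next
  assume "sigma_arc f1 X1 Y1 {0..T} \<phi>"
  then have "fst (\<phi> t) \<in> slide_set" "snd (\<phi> t) = 0" using t by (auto dest: sigma_arc_Z1D)
  then have "(fst (\<phi> t), snd (\<phi> t)) \<in> Lambda1"
    using fold_bounds by (auto simp: slide_set_def intro!: line_in_Lambda1)
  then show ?thesis by simp
qed

lemma trajectory_chain_piece:
  assumes "trajectory_chain f X Y K \<tau> P \<sigma>" "i \<in> K"
  obtains \<phi> T where "0 < T" "local_trajectory f X Y (P i) {0..T} \<phi>" "\<phi> 0 = P i" "\<phi> T = P (i + 1)"
    "{\<sigma> i t |t. \<tau> i \<le> t \<and> t \<le> \<tau> (i + 1)} = \<phi> ` {0..T}"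
proof -
  have i: "\<tau> i < \<tau> (i + 1)" "\<sigma> i (\<tau> (i + 1)) = P (i + 1)"
    and loc: "local_trajectory f X Y (P i) {0..\<tau> (i + 1) - \<tau> i} (\<lambda>s. \<sigma> i (\<tau> i + s))"
    using assms unfolding trajectory_chain_def by blast+
  have image: "{\<sigma> i t |t. \<tau> i \<le> t \<and> t \<le> \<tau> (i + 1)} = (\<lambda>s. \<sigma> i (\<tau> i + s)) ` {0..\<tau> (i + 1) - \<tau> i}"
  proof (intro equalityI subsetI)
    fix q assume "q \<in> {\<sigma> i t |t. \<tau> i \<le> t \<and> t \<le> \<tau> (i + 1)}"
    then obtain t where "q = \<sigma> i t" "\<tau> i \<le> t" "t \<le> \<tau> (i + 1)" by blast
    then show "q \<in> (\<lambda>s. \<sigma> i (\<tau> i + s)) ` {0..\<tau> (i + 1) - \<tau> i}"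
      by (intro image_eqI[of _ _ "t - \<tau> i"]) auto
  qed force
  show ?thesis
    by (rule that[OF _ loc _ _ image]) (use i loc in \<open>simp_all add: local_trajectory_def\<close>)
qed

lemma Z_invariant_Lambda1: "Z_invariant f1 X1 Y1 Lambda1"
  unfolding Z_invariant_def
proof (intro ballI allI impI)
  fix p \<Gamma> assume p: "p \<in> Lambda1" and "global_trajectory f1 X1 Y1 p \<Gamma>"
  then obtain \<tau> P \<sigma> where chain: "trajectory_chain f1 X1 Y1 UNIV \<tau> P \<sigma>" and P0: "P 0 = p"
      and \<Gamma>: "\<Gamma> = chain_image UNIV \<tau> \<sigma>" unfolding global_trajectory_def by blast
  have piece: "(P i \<in> Lambda1 \<longleftrightarrow> P (i + 1) \<in> Lambda1) \<and>
      (P i \<in> Lambda1 \<longrightarrow> {\<sigma> i t |t. \<tau> i \<le> t \<and> t \<le> \<tau> (i + 1)} \<subseteq> Lambda1)" for i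
  proof (rule trajectory_chain_piece[OF chain UNIV_I[of i]])
    fix \<phi> T assume T: "0 < T" "local_trajectory f1 X1 Y1 (P i) {0..T} \<phi>" "\<phi> 0 = P i"
      "\<phi> T = P (i + 1)" "{\<sigma> i t |t. \<tau> i \<le> t \<and> t \<le> \<tau> (i + 1)} = \<phi> ` {0..T}"
    have arc: "some_arc f1 X1 Y1 {0..T} \<phi>"
      using T(1,2) by (intro local_trajectory_Z1_some_arc) auto
    have iff: "\<phi> s \<in> Lambda1 \<longleftrightarrow> \<phi> t \<in> Lambda1" if "s \<in> {0..T}" "t \<in> {0..T}" for s t
      using some_arc_Lambda1[OF arc] that by blast
    have "P i \<in> Lambda1 \<longleftrightarrow> P (i + 1) \<in> Lambda1" using iff[of 0 T] T(1,3,4) by simp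
    moreover have "P i \<in> Lambda1 \<longrightarrow> \<phi> ` {0..T} \<subseteq> Lambda1" using iff[of 0] T(1,3) by auto
    ultimately show ?thesis unfolding T(5) ..
  qed
  have vertex: "P i \<in> Lambda1" for i
  proof (induction i rule: int_induct[where k = 0])
    case base
    then show ?case using p P0 by simp
  next
    case (step1 i)
    then show ?case using piece[of i, THEN conjunct1] by blast
  next
    case (step2 i)
    then show ?case using piece[of "i - 1", THEN conjunct1] by simp
  qed
  show "\<Gamma> \<subseteq> Lambda1"
    unfolding \<Gamma> chain_image_def
  proof (rule UN_least)
    fix i
    show "{\<sigma> i t |t. \<tau> i \<le> t \<and> t \<le> \<tau> (i + 1)} \<subseteq> Lambda1"
      by (rule piece[THEN conjunct2, THEN mp, OF vertex])
  qed
qed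

lemma compact_Lambda1: "compact Lambda1"
proof -
  have "y \<le> 13 \<and> - 1225 \<le> y" if "(x, y) \<in> Lambda1" for x y
  proof -
    have x: "- 3 \<le> x" "x \<le> 4" using Lambda1_bounds[OF that] by auto
    have "y \<le> 13"
    proof (cases "0 \<le> y")
      case True
      then have "y + x\<^sup>2 - x \<le> 12" using that Lambda1_upper by blast
      moreover have "0 \<le> (x - 1 / 2)\<^sup>2" by simp
      ultimately show ?thesis by (simp add: power2_eq_square algebra_simps)
    qed simp
    moreover have "- 1225 \<le> y"
    proof (cases "y \<le> 0")
      case True
      then have "quartic x \<le> y" using that Lambda1_lower by blast
      moreover have "((4 - x) * (3 + x)) * (x - 2)\<^sup>2 \<le> (7 * 7) * 5\<^sup>2"
        using x abs_le_square_iff[of "x - 2" 5] by (intro mult_mono) auto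
      moreover have "quartic x = - (((4 - x) * (3 + x)) * (x - 2)\<^sup>2)"
        unfolding quartic_def by (simp add: power2_eq_square algebra_simps)
      ultimately show ?thesis by simp
    qed simp
    ultimately show ?thesis ..
  qed
  then have "Lambda1 \<subseteq> {- 3..4} \<times> {- 1225..13}" using Lambda1_bounds by auto
  moreover have "bounded ({- 3..4 :: real} \<times> {- 1225..13 :: real})" by (intro bounded_Times) auto
  ultimately have "bounded Lambda1" using bounded_subset by blast
  moreover have "closed Lambda1"
    unfolding Lambda1_def case_prod_unfold
    by (intro closed_Collect_conj closed_Collect_le continuous_intros)
  ultimately show ?thesis by (simp add: compact_eq_bounded_closed)
qed

section \<open>Minimality\<close>

context Z1_equilibria
begin

text \<open>
  Membership in an invariant set is constant along every step, and the graph of steps is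
  connected. The escaping arcs link the points on each side of \<open>r0\<close>, but never cross \<open>r0\<close>. The
  parabolas of \<open>X\<^sub>1\<close> join \<open>x\<close> to \<open>1 - x\<close> and carry a neighbourhood of \<open>r0\<close> into the
  interval from \<open>22/10\<close> to \<open>27/10\<close>, inside which sliding is free to cross \<open>1 - r0\<close>; this
  joins the two sides. All other points are then reached along arcs of \<open>X\<^sub>1\<close> and \<open>Y\<^sub>1\<close>.
\<close>

lemma invariant_subset_eq_Lambda1:
  assumes inv: "Z_invariant f1 X1 Y1 N" and "N \<subseteq> Lambda1" "N \<noteq> {}"
  shows "N = Lambda1"
proof -
  have link: "p \<in> N \<longleftrightarrow> q \<in> N" if "Z1_step p q T" "p \<in> Lambda1" "q \<in> Lambda1" for p q T
    by (rule Z_invariant_step_iff[OF inv that(1) endless_Lambda1(1)[OF that(3)] endless_Lambda1(2)[OF that(2)]])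
  have line: "(x, 0) \<in> N \<longleftrightarrow> (z, 0) \<in> N"
    if "Z1_step (x, 0) (z, 0) T" "- 3 \<le> x" "x \<le> 4" "- 3 \<le> z" "z \<le> 4" for x z T
    using link[OF that(1)] that line_in_Lambda1 by simp
  have reflect: "(x, 0) \<in> N \<longleftrightarrow> (1 - x, 0) \<in> N" if "- 3 \<le> x" "x < 1 / 2" for x
    using that by (intro line[OF reflect_step]) auto
  obtain M where M: "\<forall>s\<in>slide_set. \<bar>slide s\<bar> \<le> M" using slide_bounded ..
  have slide: "(u, 0) \<in> N \<longleftrightarrow> (v, 0) \<in> N"
    if "u \<le> v" "{u..v} \<subseteq> slide_set" "\<And>s. u \<le> s \<Longrightarrow> s \<le> v \<Longrightarrow> 0 < slide s" for u v
  proof (cases "u = v")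
    case False
    have "\<exists>T. \<bar>v - u\<bar> \<le> M * T \<and> Z1_step (u, 0) (v, 0) T"
      using that False M by (intro slide_step) (auto simp: closed_segment_eq_real_ivl subset_iff)
    moreover have "u \<in> slide_set" "v \<in> slide_set" using that by auto
    then have "- 3 \<le> u" "u \<le> 4" "- 3 \<le> v" "v \<le> 4"
      using fold_bounds by (auto simp: slide_set_def)
    ultimately show ?thesis using line[of u v] by blast
  qed simp
  define c where "c \<longleftrightarrow> (- 15 / 10, 0) \<in> N"
  have right_of_r0: "(x, 0) \<in> N \<longleftrightarrow> c" if "- 15 / 10 \<le> x" "x \<le> 1 / 2" for x
    unfolding c_def using that r0 fold_bounds slide_sign(2)
    by (intro slide[symmetric]) (auto simp: slide_set_def)
  have sliding: "(x, 0) \<in> N \<longleftrightarrow> c" if "22 / 10 \<le> x" "x \<le> 27 / 10" for x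
  proof -
    have "(22 / 10, 0) \<in> N \<longleftrightarrow> (x, 0) \<in> N"
      using that r1 r2 fold_bounds slide_sign(4) by (intro slide) (auto simp: slide_set_def)
    moreover have "(- 12 / 10, 0) \<in> N \<longleftrightarrow> (22 / 10, 0) \<in> N"
      using reflect[of "- 12 / 10"] by simp
    ultimately show ?thesis using right_of_r0[of "- 12 / 10"] by simp
  qed
  have middle: "(x, 0) \<in> N \<longleftrightarrow> c" if "fold_left \<le> x" "x \<le> 2" for x
  proof -
    consider "x < - 15 / 10" | "- 15 / 10 \<le> x" "x \<le> 1 / 2" | "1 / 2 < x" by linarith
    then show ?thesis
    proof cases
      case 1
      then show ?thesis using reflect[of x] sliding[of "1 - x"] that fold_bounds by simp
    next
      case 2
      then show ?thesis using right_of_r0 by simp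
    next
      case 3
      then show ?thesis using reflect[of "1 - x"] right_of_r0[of "1 - x"] that by simp
    qed
  qed
  have left: "(x, 0) \<in> N \<longleftrightarrow> c" if x: "- 3 \<le> x" "x < fold_left" for x
  proof -
    from step_to_sewing_up[OF x] obtain z T
      where z: "fold_left < z" "z \<le> 2" "Z1_step (z, 0) (x, 0) T" by blast
    then have "(z, 0) \<in> N \<longleftrightarrow> (x, 0) \<in> N"
      using x fold_bounds by (intro line[OF z(3)]) auto
    then show ?thesis using middle[of z] z by simp
  qed
  have on_line: "(x, 0) \<in> N \<longleftrightarrow> c" if "- 3 \<le> x" "x \<le> 4" for x
  proof (cases "x \<le> 2")
    case True
    then show ?thesis using middle[of x] left[of x] that by linarith
  next
    case False
    then have "(1 - x, 0) \<in> N \<longleftrightarrow> c"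
      using middle[of "1 - x"] left[of "1 - x"] that by linarith
    then show ?thesis using reflect[of "1 - x"] that False by simp
  qed
  have all: "p \<in> N \<longleftrightarrow> c" if "p \<in> Lambda1" for p
  proof -
    obtain x y where p: "p = (x, y)" by (cases p)
    note xy = that[unfolded p]
    show ?thesis
    proof (cases "y = 0")
      case True
      then show ?thesis using on_line[of x] Lambda1_bounds[OF xy] p by simp
    next
      case False
      from step_to_line[OF xy this] obtain z T
        where z: "- 3 \<le> z" "z \<le> 4" "Z1_step (x, y) (z, 0) T" by blast
      then show ?thesis using link[OF z(3)] xy line_in_Lambda1[of z] on_line[of z] p by simp
    qed
  qed
  then show ?thesis using \<open>N \<subseteq> Lambda1\<close> \<open>N \<noteq> {}\<close> by blast
qed

section \<open>Proper half-invariant subsets\<close>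

text \<open>
  A sliding point can only slide, and \<open>r2\<close> attracts the sliding points near it.
\<close>

lemma departs_from_r2_constant:
  assumes "0 \<le> T" "local_trajectory f1 X1 Y1 (r2, 0) {0..T} \<phi>" "t \<in> {0..T}"
  shows "\<phi> t = (r2, 0)"
proof -
  have "\<phi> 0 = (r2, 0)" and arc: "sigma_arc f1 X1 Y1 {0..T} \<phi>"
    using assms(1,2) r2 fold_bounds by (auto simp: local_trajectory_Z1)
  (* Within distance 1/10 of r2 a sliding point stays to the right of r1. *)
  have "fst (\<phi> t) = r2"
  proof (rule constant_at_attractor[where x = "\<lambda>t. fst (\<phi> t)" and \<epsilon> = "1 / 10" and T = T])
    show "((\<lambda>t. fst (\<phi> t)) has_real_derivative slide (fst (\<phi> s))) (at s within {0..T})"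
      if "s \<in> {0..T}" for s using sigma_arc_Z1D(3)[OF arc that] .
    show "(fst (\<phi> s) - r2) * slide (fst (\<phi> s)) \<le> 0"
      if s: "s \<in> {0..T}" "\<bar>fst (\<phi> s) - r2\<bar> < 1 / 10" for s
    proof -
      have "r1 < fst (\<phi> s)" "fst (\<phi> s) \<le> fold_right"
        using sigma_arc_Z1D(2)[OF arc s(1)] s(2)[unfolded abs_less_iff] r1 r2 fold_bounds
        by (auto simp: slide_set_def)
      then show ?thesis
        using slide_sign(4,5)[of "fst (\<phi> s)"]
        by (cases "fst (\<phi> s)" r2 rule: linorder_cases) (simp_all add: mult_le_0_iff)
    qed
  qed (use assms \<open>\<phi> 0 = (r2, 0)\<close> in auto)
  then show ?thesis using sigma_arc_Z1D(1)[OF arc assms(3)] by (simp add: prod_eq_iff)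
qed

text \<open>
  Dually, arcs of \<open>X\<^sub>1\<close> and \<open>Y\<^sub>1\<close> only leave the escaping point \<open>r0\<close>, and
  escaping arcs near it run away from it.
\<close>

lemma arrives_at_r0_constant:
  assumes "0 < T" "some_arc f1 X1 Y1 {0..T} \<phi>" "\<phi> T = (r0, 0)" "t \<in> {0..T}"
  shows "\<phi> t = (r0, 0)"
  using assms(2) unfolding some_arc_def
proof (elim disjE)
  assume X: "X_arc f1 X1 {0..T} \<phi>"
  have "0 \<le> snd (\<phi> 0)"
    using X \<open>0 < T\<close> by (auto simp: X_arc_def integral_arc_def upper_region_def f1_def case_prod_unfold)
  moreover have "fst (\<phi> 0) = r0 - T"
    using X_arc_Z1_conserved(1)[OF X, of 0 T] assms by simp
  moreover have "snd (\<phi> 0) + (fst (\<phi> 0))\<^sup>2 - fst (\<phi> 0) = r0\<^sup>2 - r0"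
    using X_arc_Z1_conserved(2)[OF X, of 0 T] assms by simp
  ultimately have "0 \<le> r0\<^sup>2 - r0 - (r0 - T)\<^sup>2 + (r0 - T)" by simp
  also have "\<dots> = T * (2 * r0 - 1 - T)" by (simp add: algebra_simps power2_eq_square)
  also have "\<dots> < 0" using assms(1) r0 by (intro mult_pos_neg) auto
  finally show ?thesis by simp
next
  assume Y: "Y_arc f1 Y1 {0..T} \<phi>"
  (* Going back by at most 1 from r0 stays on the increasing branch up to 2. *)
  define s where "s = T - min T 1"
  have s: "s \<in> {0..T}" "T - s \<le> 1" "0 < T - s" using assms(1) by (auto simp: s_def)
  have "snd (\<phi> s) \<le> 0"
    using Y s by (auto simp: Y_arc_def integral_arc_def lower_region_def f1_def case_prod_unfold)
  moreover have "fst (\<phi> s) = r0 + (T - s)"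
    using Y_arc_Z1_conserved(1)[OF Y, of s T] assms s by simp
  moreover have "snd (\<phi> s) - quartic (fst (\<phi> s)) = - quartic r0"
    using Y_arc_Z1_conserved(2)[OF Y, of s T] assms s by simp
  moreover have "quartic r0 < quartic (r0 + (T - s))"
    using s r0 fold_bounds by (intro quartic_less_increasing) auto
  ultimately show ?thesis by simp
next
  assume arc: "sigma_arc f1 X1 Y1 {0..T} \<phi>"
  (* Reversing time turns the repelling equilibrium into an attracting one. *)
  define x where "x s = fst (\<phi> (T - s))" for s
  have dx: "(x has_real_derivative - slide (x s)) (at s within {0..T})" if "s \<in> {0..T}" for s
  proof -
    have "((\<lambda>t. fst (\<phi> t)) has_real_derivative slide (x s)) (at (T - s) within {0..T})"
      using sigma_arc_Z1D(3)[OF arc, of "T - s"] that by (simp add: x_def)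
    then have "((\<lambda>t. fst (\<phi> t)) has_real_derivative slide (x s)) (at (T - s) within (\<lambda>s. T - s) ` {0..T})"
      by simp
    moreover have "((\<lambda>s. T - s) has_real_derivative - 1) (at s within {0..T})"
      by (auto intro!: derivative_eq_intros)
    ultimately have "((\<lambda>t. fst (\<phi> t)) \<circ> (\<lambda>s. T - s) has_real_derivative slide (x s) * - 1) (at s within {0..T})"
      by (rule DERIV_image_chain)
    then show ?thesis by (simp add: x_def[abs_def] comp_def)
  qed
  have "x (T - t) = r0"
  proof (rule constant_at_attractor[where x = x and \<epsilon> = "1 / 10" and T = T, OF _ _ dx])
    show "(x s - r0) * - slide (x s) \<le> 0" if s: "s \<in> {0..T}" "\<bar>x s - r0\<bar> < 1 / 10" for s
    proof -
      have "x s \<in> slide_set" using sigma_arc_Z1D(2)[OF arc, of "T - s"] s(1) by (simp add: x_def)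
      then have "fold_left \<le> x s" "x s \<le> 1 / 2"
        using s(2) r0 fold_bounds by (auto simp: slide_set_def)
      then show ?thesis
        using slide_sign(1,2)[of "x s"]
        by (cases "x s" r0 rule: linorder_cases) (simp_all add: zero_le_mult_iff)
    qed
  qed (use assms in \<open>auto simp: x_def\<close>)
  then show ?thesis using sigma_arc_Z1D(1)[OF arc assms(4)] by (simp add: prod_eq_iff x_def)
qed

lemma positively_invariant_r2: "Z_positively_invariant f1 X1 Y1 {(r2, 0)}"
  unfolding Z_positively_invariant_def
proof (intro ballI allI impI)
  fix p \<Gamma> assume p: "p \<in> {(r2, 0)}" and "positive_global_trajectory f1 X1 Y1 p \<Gamma>"
  then obtain \<tau> P \<sigma> where chain: "trajectory_chain f1 X1 Y1 {0..} \<tau> P \<sigma>" and "P 0 = p"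
      and \<Gamma>: "\<Gamma> = chain_image {0..} \<tau> \<sigma>" unfolding positive_global_trajectory_def by blast
  then have P0: "P 0 = (r2, 0)" using p by simp
  have piece: "P (i + 1) = (r2, 0) \<and> {\<sigma> i t |t. \<tau> i \<le> t \<and> t \<le> \<tau> (i + 1)} \<subseteq> {(r2, 0)}"
    if "0 \<le> i" "P i = (r2, 0)" for i
  proof (rule trajectory_chain_piece[OF chain, of i])
    fix \<phi> T assume T: "0 < T" "local_trajectory f1 X1 Y1 (P i) {0..T} \<phi>" "\<phi> 0 = P i"
      "\<phi> T = P (i + 1)" "{\<sigma> i t |t. \<tau> i \<le> t \<and> t \<le> \<tau> (i + 1)} = \<phi> ` {0..T}"
    have const: "\<phi> t = (r2, 0)" if "t \<in> {0..T}" for t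
      using departs_from_r2_constant[of T \<phi> t] T(1,2) \<open>P i = (r2, 0)\<close> that by simp
    then have "P (i + 1) = (r2, 0)" using T(1,4) by force
    then show ?thesis unfolding T(5) using const by auto
  qed (use that in simp)
  have vertex: "P i = (r2, 0)" if "0 \<le> i" for i
    using that
  proof (induction i rule: int_ge_induct)
    case (step i)
    from piece[OF step] show ?case ..
  qed (rule P0)
  show "\<Gamma> \<subseteq> {(r2, 0)}"
    unfolding \<Gamma> chain_image_def
  proof (rule UN_least)
    fix i :: int assume "i \<in> {0..}"
    then have "0 \<le> i" by simp
    from piece[OF this vertex[OF this]]
    show "{\<sigma> i t |t. \<tau> i \<le> t \<and> t \<le> \<tau> (i + 1)} \<subseteq> {(r2, 0)}" ..
  qed
qed

lemma negatively_invariant_r0: "Z_negatively_invariant f1 X1 Y1 {(r0, 0)}"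
  unfolding Z_negatively_invariant_def
proof (intro ballI allI impI)
  fix p \<Gamma> assume p: "p \<in> {(r0, 0)}" and "negative_global_trajectory f1 X1 Y1 p \<Gamma>"
  then obtain \<tau> P \<sigma> where chain: "trajectory_chain f1 X1 Y1 {..- 1} \<tau> P \<sigma>" and "P 0 = p"
      and \<Gamma>: "\<Gamma> = chain_image {..- 1} \<tau> \<sigma>" unfolding negative_global_trajectory_def by blast
  then have P0: "P 0 = (r0, 0)" using p by simp
  have piece: "P i = (r0, 0) \<and> {\<sigma> i t |t. \<tau> i \<le> t \<and> t \<le> \<tau> (i + 1)} \<subseteq> {(r0, 0)}"
    if "i \<le> - 1" "P (i + 1) = (r0, 0)" for i
  proof (rule trajectory_chain_piece[OF chain, of i])
    fix \<phi> T assume T: "0 < T" "local_trajectory f1 X1 Y1 (P i) {0..T} \<phi>" "\<phi> 0 = P i"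
      "\<phi> T = P (i + 1)" "{\<sigma> i t |t. \<tau> i \<le> t \<and> t \<le> \<tau> (i + 1)} = \<phi> ` {0..T}"
    have arc: "some_arc f1 X1 Y1 {0..T} \<phi>"
      using T(1,2) by (intro local_trajectory_Z1_some_arc) auto
    have const: "\<phi> t = (r0, 0)" if "t \<in> {0..T}" for t
      using arrives_at_r0_constant[OF T(1) arc _ that] T(4) \<open>P (i + 1) = (r0, 0)\<close> by simp
    then have "P i = (r0, 0)" using T(1,3) by force
    then show ?thesis unfolding T(5) using const by auto
  qed (use that in simp)
  have vertex: "P i = (r0, 0)" if "i \<le> 0" for i
    using that
  proof (induction i rule: int_le_induct)
    case (step i)
    then show ?case using piece[of "i - 1", THEN conjunct1] by simp
  qed (rule P0)
  show "\<Gamma> \<subseteq> {(r0, 0)}"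
    unfolding \<Gamma> chain_image_def
  proof (rule UN_least)
    fix i :: int assume "i \<in> {..- 1}"
    then have "i \<le> - 1" "i + 1 \<le> 0" by simp_all
    from piece[OF this(1) vertex[OF this(2)]]
    show "{\<sigma> i t |t. \<tau> i \<le> t \<and> t \<le> \<tau> (i + 1)} \<subseteq> {(r0, 0)}" ..
  qed
qed

end

theorem proposition1:
  shows "Z_minimal f1 X1 Y1 Lambda1 \<and>
         \<not> Z_positively_minimal f1 X1 Y1 Lambda1 \<and>
         \<not> Z_negatively_minimal f1 X1 Y1 Lambda1"
proof -
  obtain r0 r1 r2 where "Z1_equilibria r0 r1 r2" using Z1_equilibria_exist by auto
  then interpret Z1_equilibria r0 r1 r2 .
  have in_Lambda1: "(2, 0) \<in> Lambda1" "(r0, 0) \<in> Lambda1" "(r2, 0) \<in> Lambda1"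
    using r0 r2 by (auto intro!: line_in_Lambda1)
  have "(2, 0) \<notin> {(r0, 0)}" "(2, 0) \<notin> {(r2, 0)}"
    using r0 r2 by auto
  then have proper: "{(r0, 0)} \<subset> Lambda1" "{(r2, 0)} \<subset> Lambda1"
    using in_Lambda1 by blast+
  have "Z_minimal f1 X1 Y1 Lambda1"
    unfolding Z_minimal_def minimal_for_def
    using in_Lambda1(1) compact_Lambda1 Z_invariant_Lambda1 invariant_subset_eq_Lambda1 by blast
  moreover have "\<not> Z_positively_minimal f1 X1 Y1 Lambda1"
    unfolding Z_positively_minimal_def minimal_for_def
    using proper(2) positively_invariant_r2 compact_sing[of "(r2, 0 :: real)"] by blast
  moreover have "\<not> Z_negatively_minimal f1 X1 Y1 Lambda1"
    unfolding Z_negatively_minimal_def minimal_for_def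
    using proper(1) negatively_invariant_r0 compact_sing[of "(r0, 0 :: real)"] by blast
  ultimately show ?thesis by blast
qed

end
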